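(* Let $L:\mathbb{L}^2(O)\to\mathbb{L}^2(M)$ be a reconstruction operator with respect to $X_i^O$, i.e. a linear operator with $\mathbb{V}(L(X_i^O)(u))<\infty$ for all $u\in M$. Then for each $u\in M$ there exists a unique (deterministic) parameter function $\alpha_u\in H$ such that almost surely $$L(X_i^O)(u)=\langle\alpha_u,X_i^O\rangle_H,\qquad u\in M,$$ where $H:=\{f\in\mathbb{L}^2(O):\ \|f\|_H^2<\infty\}$ is a Hilbert space with inner product $\langle f,g\rangle_H:=\sum_{k=1}^\infty\langle f,\phi_k^O\rangle_2\,\langle g,\phi_k^O\rangle_2/\lambda_k^O$ and induced norm $\|f\|_H=\sqrt{\langle f,f\rangle_H}$.
   Context: Let $[a,b]\subset\mathbb{R}$ and let $X_i$ be a continuous random function on $[a,b]$, an element of $\mathbb{L}^2([a,b])$, centered ($\mathbb{E}(X_i(u))=0$ for all $u$), with $\mathbb{E}(\|X_i\|_2^4)<\infty$. Let $O=\bigcup_{j=1}^J[A_j,B_j]\subseteq[a,b]$, $1\le J<\infty$, be a union of mutually disjoint subintervals (observed part; fixed, $X_i$ being independent of the observation domain) of positive length, and $M=[a,b]\setminus O$ (missing part). $X_i^O$ and $X_i^M$ denote $X_i$ restricted to $O$ and $M$. $\langle\cdot,\cdot\rangle_2$ and $\|\cdot\|_2$ are the inner product and norm of $\mathbb{L}^2(O)$. $\mathbb{V}$ denotes variance. Let $\gamma^O(u,v)=\mathrm{Cov}(X_i^O(u),X_i^O(v))$, $u,v\in O$, and let $(\phi_k^O,\lambda_k^O)_{k\ge1}$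 be the pairs of orthonormal eigenfunctions and nonzero eigenvalues $\lambda_1^O>\lambda_2^O>\dots>0$ of the covariance operator $x\mapsto\int_O\gamma^O(\cdot,v)x(v)\,dv$ on $\mathbb{L}^2(O)$. $X_i^O$ has the Karhunen-Loève representation $X_i^O(u)=\sum_{k\ge1}\xi_{ik}^O\phi_k^O(u)$, $u\in O$, with $\xi_{ik}^O=\langle X_i^O,\phi_k^O\rangle_2$, $\mathbb{E}(\xi_{ik}^O)=0$, $\mathbb{E}(\xi_{ik}^O\xi_{il}^O)=\lambda_k^O$ if $k=l$ and $0$ otherwise. The space $H$ is the reproducing kernel Hilbert space with reproducing kernel $\gamma^O(u,v)=\sum_k\lambda_k^O\phi_k^O(u)\phi_k^O(v)$; accordingly its elements are understood as lying in the closed linear span of $\{\phi_k^O\}_{k\ge1}$. For $\alpha\in H$, the expression $\langle\alpha,X_i^O\rangle_H$ denotes the random series $\sum_{k=1}^\infty \xi_{ik}^O\,\langle\alpha,\phi_k^O\rangle_2/\lambda_k^O$ (the path $X_i^O$ itself need not belong to $H$).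
   Formalization: Adds the hypothesis that for each u in M, L applied to the remainder of the Karhunen-Loève expansion of X^O tends to 0 in mean square at u; for unbounded linear L with finite variance alone the claim is false. The series ⟨α,X⟩_H is summed in mean square. *)

theory Defs
  imports "HOL-Probability.Probability"
begin

text \<open>
  Elements of an \<open>L\<^sup>2\<close> space are represented by Borel functions; two such functions are the same
  element iff they agree almost everywhere. The same notions serve for \<open>L\<^sup>2\<close> of a subset of the
  line and for \<open>L\<^sup>2\<close> of the underlying probability space.
\<close>

abbreviation lborel_on :: "real set \<Rightarrow> real measure" where
  "lborel_on S \<equiv> restrict_space lborel S"

definition L2 :: "'a measure \<Rightarrow> ('a \<Rightarrow> real) set" where
  "L2 N = {f \<in> borel_measurable N. integrable N (\<lambda>x. (f x)\<^sup>2)}"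

definition L2_inner :: "'a measure \<Rightarrow> ('a \<Rightarrow> real) \<Rightarrow> ('a \<Rightarrow> real) \<Rightarrow> real" where
  "L2_inner N f g = (\<integral>x. f x * g x \<partial>N)"

definition L2_norm :: "'a measure \<Rightarrow> ('a \<Rightarrow> real) \<Rightarrow> real" where
  "L2_norm N f = sqrt (L2_inner N f f)"

definition ae_eq :: "'a measure \<Rightarrow> ('a \<Rightarrow> real) \<Rightarrow> ('a \<Rightarrow> real) \<Rightarrow> bool" where
  "ae_eq N f g \<longleftrightarrow> (AE x in N. f x = g x)"

definition closed_span :: "'a measure \<Rightarrow> (nat \<Rightarrow> 'a \<Rightarrow> real) \<Rightarrow> ('a \<Rightarrow> real) set" where
  "closed_span N \<phi> = {f \<in> L2 N. \<forall>\<epsilon>>0. \<exists>n c. L2_norm N (\<lambda>x. f x - (\<Sum>k<n. c k * \<phi> k x)) < \<epsilon>}"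

text \<open>
  A Hilbert space whose elements are the almost-everywhere classes of the functions in \<open>S\<close>.
\<close>

definition hilbert_space_ae ::
  "'a measure \<Rightarrow> ('a \<Rightarrow> real) set \<Rightarrow> (('a \<Rightarrow> real) \<Rightarrow> ('a \<Rightarrow> real) \<Rightarrow> real) \<Rightarrow> bool" where
  "hilbert_space_ae N S ip \<longleftrightarrow>
     S \<subseteq> borel_measurable N \<and>
     (\<lambda>_. 0) \<in> S \<and>
     (\<forall>f\<in>S. \<forall>g\<in>S. (\<lambda>x. f x + g x) \<in> S) \<and>
     (\<forall>f\<in>S. \<forall>c. (\<lambda>x. c * f x) \<in> S) \<and>
     (\<forall>f\<in>S. \<forall>g\<in>borel_measurable N. ae_eq N f g \<longrightarrow> g \<in> S \<and> (\<forall>h\<in>S. ip f h = ip g h)) \<and>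
     (\<forall>f\<in>S. \<forall>g\<in>S. ip f g = ip g f) \<and>
     (\<forall>f\<in>S. \<forall>g\<in>S. \<forall>h\<in>S. ip (\<lambda>x. f x + g x) h = ip f h + ip g h) \<and>
     (\<forall>f\<in>S. \<forall>g\<in>S. \<forall>c. ip (\<lambda>x. c * f x) g = c * ip f g) \<and>
     (\<forall>f\<in>S. 0 \<le> ip f f) \<and>
     (\<forall>f\<in>S. ip f f = 0 \<longleftrightarrow> ae_eq N f (\<lambda>_. 0)) \<and>
     (\<forall>F. (\<forall>n. F n \<in> S) \<and>
          (\<forall>\<epsilon>>0. \<exists>n0::nat. \<forall>m\<ge>n0. \<forall>n\<ge>n0.
             sqrt (ip (\<lambda>x. F m x - F n x) (\<lambda>x. F m x - F n x)) < \<epsilon>)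
        \<longrightarrow> (\<exists>f\<in>S. (\<lambda>n. sqrt (ip (\<lambda>x. F n x - f x) (\<lambda>x. F n x - f x))) \<longlonglongrightarrow> 0))"

definition covariance :: "'w measure \<Rightarrow> ('w \<Rightarrow> real) \<Rightarrow> ('w \<Rightarrow> real) \<Rightarrow> real" where
  "covariance P Y Z = (\<integral>\<omega>. (Y \<omega> - (\<integral>w. Y w \<partial>P)) * (Z \<omega> - (\<integral>w. Z w \<partial>P)) \<partial>P)"

text \<open>
  \<open>E \<parallel>X\<parallel>\<^sup>2 < \<infinity>\<close> gives \<open>E (X(u))\<^sup>2 < \<infinity>\<close> for almost every \<open>u\<close>, so the kernel is a genuine covariance
  off a null set of arguments, and the operator does not depend on the values on that null set.
\<close>

definition cov_kernel :: "'w measure \<Rightarrow> ('w \<Rightarrow> real \<Rightarrow> real) \<Rightarrow> real \<Rightarrow> real \<Rightarrow> real" where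
  "cov_kernel P X u v = covariance P (\<lambda>\<omega>. X \<omega> u) (\<lambda>\<omega>. X \<omega> v)"

definition cov_operator ::
  "'w measure \<Rightarrow> ('w \<Rightarrow> real \<Rightarrow> real) \<Rightarrow> real measure \<Rightarrow> (real \<Rightarrow> real) \<Rightarrow> real \<Rightarrow> real" where
  "cov_operator P X N x = (\<lambda>u. \<integral>v. cov_kernel P X u v * x v \<partial>N)"

text \<open>
  All orthonormal eigenfunctions with nonzero eigenvalues, numbered from 0. As the eigenvalues
  strictly decrease, every eigenspace of a nonzero eigenvalue is one-dimensional.
\<close>

definition eigensystem ::
  "'a measure \<Rightarrow> (('a \<Rightarrow> real) \<Rightarrow> 'a \<Rightarrow> real) \<Rightarrow> (nat \<Rightarrow> 'a \<Rightarrow> real) \<Rightarrow> (nat \<Rightarrow> real) \<Rightarrow> bool" where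
  "eigensystem N T \<phi> lam \<longleftrightarrow>
     (\<forall>k. \<phi> k \<in> L2 N) \<and>
     (\<forall>k l. L2_inner N (\<phi> k) (\<phi> l) = (if k = l then 1 else 0)) \<and>
     (\<forall>k l. k < l \<longrightarrow> lam l < lam k) \<and>
     (\<forall>k. 0 < lam k) \<and>
     (\<forall>k. ae_eq N (T (\<phi> k)) (\<lambda>u. lam k * \<phi> k u)) \<and>
     (\<forall>x\<in>L2 N. \<forall>\<mu>. \<mu> \<noteq> 0 \<and> \<not> ae_eq N x (\<lambda>_. 0) \<and> ae_eq N (T x) (\<lambda>u. \<mu> * x u) \<longrightarrow>
        (\<exists>k c. \<mu> = lam k \<and> ae_eq N x (\<lambda>u. c * \<phi> k u)))"

definition score ::
  "real measure \<Rightarrow> (nat \<Rightarrow> real \<Rightarrow> real) \<Rightarrow> ('w \<Rightarrow> real \<Rightarrow> real) \<Rightarrow> nat \<Rightarrow> 'w \<Rightarrow> real" where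
  "score N \<phi> X k \<omega> = L2_inner N (X \<omega>) (\<phi> k)"

definition H_space ::
  "'a measure \<Rightarrow> (nat \<Rightarrow> 'a \<Rightarrow> real) \<Rightarrow> (nat \<Rightarrow> real) \<Rightarrow> ('a \<Rightarrow> real) set" where
  "H_space N \<phi> lam = {f \<in> closed_span N \<phi>. summable (\<lambda>k. (L2_inner N f (\<phi> k))\<^sup>2 / lam k)}"

definition H_inner ::
  "'a measure \<Rightarrow> (nat \<Rightarrow> 'a \<Rightarrow> real) \<Rightarrow> (nat \<Rightarrow> real) \<Rightarrow> ('a \<Rightarrow> real) \<Rightarrow> ('a \<Rightarrow> real) \<Rightarrow> real" where
  "H_inner N \<phi> lam f g = (\<Sum>k. L2_inner N f (\<phi> k) * L2_inner N g (\<phi> k) / lam k)"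

text \<open>
  \<open>Z\<close> is (a version of) the random series \<open>\<langle>\<alpha>, X\<rangle>\<^sub>H\<close>. The scores are uncorrelated but not
  independent, and a series of orthogonal random variables with summable variances need not converge
  almost surely; its sum is the mean-square limit, which is determined up to null sets.
\<close>

definition is_H_pairing ::
  "'w measure \<Rightarrow> real measure \<Rightarrow> (nat \<Rightarrow> real \<Rightarrow> real) \<Rightarrow> (nat \<Rightarrow> real) \<Rightarrow> ('w \<Rightarrow> real \<Rightarrow> real)
     \<Rightarrow> (real \<Rightarrow> real) \<Rightarrow> ('w \<Rightarrow> real) \<Rightarrow> bool" where
  "is_H_pairing P N \<phi> lam X \<alpha> Z \<longleftrightarrow>
     (\<forall>k. score N \<phi> X k \<in> L2 P) \<and> Z \<in> L2 P \<and>
     (\<lambda>n. L2_norm P (\<lambda>\<omega>. Z \<omega> - (\<Sum>k<n. score N \<phi> X k \<omega> * L2_inner N \<alpha> (\<phi> k) / lam k)))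
       \<longlonglongrightarrow> 0"

text \<open>
  Point values of \<open>L f\<close> refer to a choice of representatives for which evaluation at every point is
  linear. No boundedness is required.
\<close>

definition L2_linear_operator ::
  "'a measure \<Rightarrow> 'b measure \<Rightarrow> (('a \<Rightarrow> real) \<Rightarrow> 'b \<Rightarrow> real) \<Rightarrow> bool" where
  "L2_linear_operator N N' L \<longleftrightarrow>
     (\<forall>f\<in>L2 N. L f \<in> L2 N') \<and>
     (\<forall>f\<in>L2 N. \<forall>g\<in>L2 N. ae_eq N f g \<longrightarrow> (\<forall>u\<in>space N'. L f u = L g u)) \<and>
     (\<forall>f\<in>L2 N. \<forall>g\<in>L2 N. \<forall>u\<in>space N'. L (\<lambda>x. f x + g x) u = L f u + L g u) \<and>
     (\<forall>f\<in>L2 N. \<forall>c. \<forall>u\<in>space N'. L (\<lambda>x. c * f x) u = c * L f u)"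

definition finite_variance :: "'w measure \<Rightarrow> ('w \<Rightarrow> real) \<Rightarrow> bool" where
  "finite_variance P Y \<longleftrightarrow>
     Y \<in> borel_measurable P \<and> integrable P Y \<and> integrable P (\<lambda>\<omega>. (Y \<omega> - (\<integral>w. Y w \<partial>P))\<^sup>2)"

definition reconstruction_operator ::
  "'w measure \<Rightarrow> ('w \<Rightarrow> real \<Rightarrow> real) \<Rightarrow> real measure \<Rightarrow> real measure
     \<Rightarrow> ((real \<Rightarrow> real) \<Rightarrow> real \<Rightarrow> real) \<Rightarrow> bool" where
  "reconstruction_operator P X N N' L \<longleftrightarrow>
     L2_linear_operator N N' L \<and> (\<forall>u\<in>space N'. finite_variance P (\<lambda>\<omega>. L (X \<omega>) u))"

text \<open>
  Mean-square continuity of \<open>L\<close> along the Karhunen-Loeve expansion: the remainders of the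
  expansion of \<open>X\<close> are mapped to random variables that vanish in mean square. This is what it means
  to apply \<open>L\<close> to the expansion, and it does not follow from linearity and finite variance. Let
  \<open>\<epsilon>\<^sub>k\<close> be independent signs, \<open>T\<close> the first time at which \<open>\<epsilon>\<^sub>1 + \<dots> + \<epsilon>\<^sub>n = 1\<close>, and
  \<open>X = (\<Sum>k\<le>T. 2^(-k) * \<epsilon>\<^sub>k * \<phi>\<^sub>k)\<close>, so that the scores are \<open>2^(-k) * \<epsilon>\<^sub>k\<close> on \<open>k \<le> T\<close> and 0 otherwise.
  A linear \<open>L\<close> with \<open>L \<phi>\<^sub>k = 2^k\<close> maps \<open>X\<close> to the constant 1 almost surely, which has variance 0 but
  is not the mean-square limit of combinations of the centered scores.
\<close>

definition mean_square_continuous_along_KL ::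
  "'w measure \<Rightarrow> real measure \<Rightarrow> (nat \<Rightarrow> real \<Rightarrow> real) \<Rightarrow> ('w \<Rightarrow> real \<Rightarrow> real)
     \<Rightarrow> real measure \<Rightarrow> ((real \<Rightarrow> real) \<Rightarrow> real \<Rightarrow> real) \<Rightarrow> bool" where
  "mean_square_continuous_along_KL P N \<phi> X N' L \<longleftrightarrow>
     (\<forall>u\<in>space N'.
        (\<lambda>n. L2_norm P (\<lambda>\<omega>. L (\<lambda>t. X \<omega> t - (\<Sum>k<n. score N \<phi> X k \<omega> * \<phi> k t)) u)) \<longlonglongrightarrow> 0)"

end

theory Submission
  imports Defs
begin

text \<open>
  Write \<open>\<xi> k\<close> for the scores \<open>\<langle>X, \<phi> k\<rangle>\<close>. Fix a missing point \<open>u\<close> and put \<open>Y = L X u\<close>, a random variable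
  with finite second moment. Linearity of \<open>L\<close> gives
  \<open>Y = (\<Sum>k<n. L (\<phi> k) u * \<xi> k) + L (X - (\<Sum>k<n. \<xi> k * \<phi> k)) u\<close>, and the last term vanishes in mean square
  by continuity along the expansion. So \<open>Y\<close> is the mean-square sum of a series in the scores. The
  scores are orthogonal in \<open>L\<^sup>2\<close> of the probability space with squared norms \<open>lam k\<close>, hence
  \<open>E (Y * \<xi> k) = L (\<phi> k) u * lam k\<close>, and Bessel's inequality for \<open>\<xi> k / sqrt (lam k)\<close> gives
  \<open>(\<Sum>k. (E (Y * \<xi> k))\<^sup>2 / lam k) < \<infinity>\<close>. This is exactly the condition that the numbers \<open>E (Y * \<xi> k)\<close>
  are the coefficients of some \<open>\<alpha>\<close> in \<open>H\<close>, and \<open>\<langle>\<alpha>, X\<rangle>\<^sub>H\<close> is then the series for \<open>Y\<close>. Conversely, if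
  \<open>Y = \<langle>\<beta>, X\<rangle>\<^sub>H\<close>, then pairing with \<open>\<xi> k\<close> shows that \<open>\<beta>\<close> has the coefficients \<open>E (Y * \<xi> k)\<close>, and
  an element of the closed span of the \<open>\<phi> k\<close> is determined by its coefficients.

  Three ingredients carry this argument. The first is Hilbert space theory for functions modulo null
  sets: completeness of \<open>L\<^sup>2\<close> (\<open>L2_complete\<close>), Bessel's and Parseval's inequalities, and the existence
  of functions with prescribed coefficients (\<open>Riesz_Fischer\<close>). The second is that \<open>H\<close> is a Hilbert space
  (\<open>H_space_hilbert\<close>); it is isometric to the closed span of the \<open>\<phi> k\<close> by dividing the coefficients by
  \<open>sqrt (lam k)\<close>. The third is the covariance of the scores (\<open>score_covariance_eigenfunction\<close>), which
  follows from the eigenvalue equation by Fubini's theorem; its use rests on the joint measurability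
  of a process with continuous paths (\<open>continuous_paths_jointly_measurable\<close>) and on
  \<open>E \<parallel>X\<parallel>\<^sup>2 < \<infinity>\<close>.
\<close>

section \<open>Square-integrable functions as a semi-inner product space\<close>

lemma L2_measurable: "f \<in> L2 M \<Longrightarrow> f \<in> borel_measurable M"
  and L2_square_integrable: "f \<in> L2 M \<Longrightarrow> integrable M (\<lambda>x. (f x)\<^sup>2)"
  by (auto simp: L2_def)

lemma abs_mult_le_sum_squares: "\<bar>s * t\<bar> \<le> s\<^sup>2 + t\<^sup>2" for s t :: real
proof -
  have "2 * (s * t) \<le> s\<^sup>2 + t\<^sup>2" "- (2 * (s * t)) \<le> s\<^sup>2 + t\<^sup>2" "0 \<le> s\<^sup>2 + t\<^sup>2"
    using zero_le_power2[of "s - t"] zero_le_power2[of "s + t"]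
    by (auto simp: power2_diff power2_sum)
  then show ?thesis by linarith
qed

lemma L2_mult_integrable:
  assumes f: "f \<in> L2 M" and g: "g \<in> L2 M"
  shows "integrable M (\<lambda>x. f x * g x)"
proof (rule Bochner_Integration.integrable_bound)
  show "integrable M (\<lambda>x. (f x)\<^sup>2 + (g x)\<^sup>2)"
    using assms by (auto simp: L2_def)
  show "(\<lambda>x. f x * g x) \<in> borel_measurable M"
    using assms[THEN L2_measurable] by measurable
  show "AE x in M. norm (f x * g x) \<le> norm ((f x)\<^sup>2 + (g x)\<^sup>2)"
    by (simp add: abs_mult_le_sum_squares)
qed

lemma L2_zero [simp]: "(\<lambda>_. 0) \<in> L2 M"
  by (simp add: L2_def)

lemma L2_add:
  assumes "f \<in> L2 M" and "g \<in> L2 M"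
  shows "(\<lambda>x. f x + g x) \<in> L2 M"
  using L2_mult_integrable[OF assms] assms by (auto simp: L2_def power2_sum mult.assoc)

lemma L2_scale: "f \<in> L2 M \<Longrightarrow> (\<lambda>x. c * f x) \<in> L2 M"
  by (auto simp: L2_def power_mult_distrib)

lemma L2_diff:
  assumes "f \<in> L2 M" and "g \<in> L2 M"
  shows "(\<lambda>x. f x - g x) \<in> L2 M"
  using L2_add[OF assms(1) L2_scale[OF assms(2), of "-1"]] by simp

lemma L2_sum:
  assumes "\<And>i. i \<in> I \<Longrightarrow> f i \<in> L2 M"
  shows "(\<lambda>x. \<Sum>i\<in>I. f i x) \<in> L2 M"
  using assms by (induction I rule: infinite_finite_induct) (auto intro: L2_add)

lemma L2_ae_eq:
  assumes "f \<in> L2 M" and "g \<in> borel_measurable M" and "ae_eq M f g"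
  shows "g \<in> L2 M"
proof -
  have "integrable M (\<lambda>x. (f x)\<^sup>2) \<longleftrightarrow> integrable M (\<lambda>x. (g x)\<^sup>2)"
    using assms by (intro integrable_cong_AE) (auto simp: ae_eq_def L2_def)
  then show ?thesis
    using assms by (simp add: L2_def)
qed

lemma L2_inner_commute: "L2_inner M f g = L2_inner M g f"
  by (simp add: L2_inner_def mult.commute)

lemma L2_inner_zero_left [simp]: "L2_inner M (\<lambda>_. 0) g = 0"
  by (simp add: L2_inner_def)

lemma L2_inner_add_left:
  assumes "f \<in> L2 M" and "g \<in> L2 M" and "h \<in> L2 M"
  shows "L2_inner M (\<lambda>x. f x + g x) h = L2_inner M f h + L2_inner M g h"
  using assms by (simp add: L2_inner_def distrib_right L2_mult_integrable)

lemma L2_inner_add_right: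
  assumes "f \<in> L2 M" and "g \<in> L2 M" and "h \<in> L2 M"
  shows "L2_inner M h (\<lambda>x. f x + g x) = L2_inner M h f + L2_inner M h g"
  using L2_inner_add_left[OF assms] by (simp add: L2_inner_commute)

lemma L2_inner_scale_left: "L2_inner M (\<lambda>x. c * f x) g = c * L2_inner M f g"
  by (simp add: L2_inner_def mult.assoc)

lemma L2_inner_diff_left:
  assumes "f \<in> L2 M" and "g \<in> L2 M" and "h \<in> L2 M"
  shows "L2_inner M (\<lambda>x. f x - g x) h = L2_inner M f h - L2_inner M g h"
  using assms by (simp add: L2_inner_def left_diff_distrib L2_mult_integrable)

lemma L2_inner_diff_right:
  assumes "f \<in> L2 M" and "g \<in> L2 M" and "h \<in> L2 M"
  shows "L2_inner M h (\<lambda>x. f x - g x) = L2_inner M h f - L2_inner M h g"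
  using L2_inner_diff_left[OF assms] by (simp add: L2_inner_commute)

lemma L2_inner_sum_left:
  assumes "\<And>i. i \<in> I \<Longrightarrow> f i \<in> L2 M" and "h \<in> L2 M"
  shows "L2_inner M (\<lambda>x. \<Sum>i\<in>I. f i x) h = (\<Sum>i\<in>I. L2_inner M (f i) h)"
  using assms by (simp add: L2_inner_def sum_distrib_right L2_mult_integrable)

lemma L2_inner_ae_eq:
  assumes "f \<in> L2 M" and "g \<in> L2 M" and "h \<in> L2 M" and "ae_eq M f g"
  shows "L2_inner M f h = L2_inner M g h"
  unfolding L2_inner_def using assms by (intro integral_cong_AE) (auto simp: ae_eq_def L2_def)

lemma L2_inner_self_nonneg [simp]: "0 \<le> L2_inner M f f"
  by (simp add: L2_inner_def)

lemma L2_inner_self_eq_0_iff: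
  assumes "f \<in> L2 M"
  shows "L2_inner M f f = 0 \<longleftrightarrow> ae_eq M f (\<lambda>_. 0)"
  using integral_nonneg_eq_0_iff_AE[OF L2_square_integrable[OF assms]]
  by (simp add: L2_inner_def ae_eq_def power2_eq_square)

lemma L2_norm_nonneg [simp]: "0 \<le> L2_norm M f"
  by (simp add: L2_norm_def)

lemma L2_norm_square: "(L2_norm M f)\<^sup>2 = L2_inner M f f"
  by (simp add: L2_norm_def)

lemma L2_norm_diff_commute: "L2_norm M (\<lambda>x. f x - g x) = L2_norm M (\<lambda>x. g x - f x)"
proof -
  have "(f x - g x) * (f x - g x) = (g x - f x) * (g x - f x)" for x
    by (simp add: algebra_simps)
  then show ?thesis
    unfolding L2_norm_def L2_inner_def by simp
qed

lemma L2_norm_diff_square: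
  assumes f: "f \<in> L2 M" and g: "g \<in> L2 M"
  shows "(L2_norm M (\<lambda>x. f x - g x))\<^sup>2 = L2_inner M f f - 2 * L2_inner M f g + L2_inner M g g"
  unfolding L2_norm_square
  using assms by (simp add: L2_diff L2_inner_diff_left L2_inner_diff_right L2_inner_commute[of M g f])

lemma L2_Cauchy_Schwarz:
  assumes f: "f \<in> L2 M" and g: "g \<in> L2 M"
  shows "\<bar>L2_inner M f g\<bar> \<le> L2_norm M f * L2_norm M g"
proof -
  define p q where "p = L2_inner M f g" and "q = L2_inner M g g"
  have quad: "0 \<le> L2_inner M f f - 2 * c * p + c\<^sup>2 * q" for c
  proof -
    have "0 \<le> (L2_norm M (\<lambda>x. f x - c * g x))\<^sup>2" by simp
    also have "\<dots> = L2_inner M f f - 2 * c * p + c\<^sup>2 * q"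
      using L2_norm_diff_square[OF f L2_scale[OF g, of c]]
        L2_inner_commute[of M f "\<lambda>x. c * g x"] L2_inner_commute[of M g "\<lambda>x. c * g x"]
        L2_inner_commute[of M g f]
      by (simp add: p_def q_def L2_inner_scale_left power2_eq_square)
    finally show ?thesis .
  qed
  have "p\<^sup>2 \<le> L2_inner M f f * q"
  proof (cases "q = 0")
    case True
    \<comment> \<open>The quadratic is then affine, and it is negative at this point unless its slope vanishes.\<close>
    have "p = 0"
    proof (rule ccontr)
      assume "p \<noteq> 0"
      then show False
        using quad[of "(L2_inner M f f + 1) / (2 * p)"] True by simp
    qed
    then show ?thesis using True by simp
  next
    case False
    then have "0 < q" using L2_inner_self_nonneg[of M g] unfolding q_def by linarith
    then show ?thesis
      using quad[of "p / q"] by (simp add: field_simps power2_eq_square)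
  qed
  then have "sqrt (p\<^sup>2) \<le> sqrt (L2_inner M f f * q)" by (rule real_sqrt_le_mono)
  then show ?thesis
    by (simp add: p_def q_def L2_norm_def real_sqrt_mult)
qed

lemma L2_norm_triangle:
  assumes f: "f \<in> L2 M" and g: "g \<in> L2 M"
  shows "L2_norm M (\<lambda>x. f x + g x) \<le> L2_norm M f + L2_norm M g"
proof (rule power2_le_imp_le)
  have "(L2_norm M (\<lambda>x. f x + g x))\<^sup>2 = L2_inner M f f + 2 * L2_inner M f g + L2_inner M g g"
    unfolding L2_norm_square using f g
    by (simp add: L2_add L2_inner_add_left L2_inner_add_right L2_inner_commute[of M g f])
  also have "\<dots> \<le> (L2_norm M f + L2_norm M g)\<^sup>2"
    using L2_Cauchy_Schwarz[OF f g] by (simp add: power2_sum L2_norm_square)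
  finally show "(L2_norm M (\<lambda>x. f x + g x))\<^sup>2 \<le> (L2_norm M f + L2_norm M g)\<^sup>2" .
qed simp

lemma L2_norm_scale: "L2_norm M (\<lambda>x. c * f x) = \<bar>c\<bar> * L2_norm M f"
proof -
  have "(\<lambda>x. c * f x * (c * f x)) = (\<lambda>x. c\<^sup>2 * (f x * f x))"
    by (simp add: power2_eq_square fun_eq_iff)
  then have "L2_inner M (\<lambda>x. c * f x) (\<lambda>x. c * f x) = c\<^sup>2 * L2_inner M f f"
    by (simp add: L2_inner_def del: mult_eq_0_iff mult_cancel_left mult_cancel_right)
  then show ?thesis
    by (simp add: L2_norm_def real_sqrt_mult)
qed

lemma L2_norm_ae_eq:
  assumes "f \<in> borel_measurable M" and "g \<in> borel_measurable M" and "ae_eq M f g"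
  shows "L2_norm M f = L2_norm M g"
proof -
  have "(\<integral>x. f x * f x \<partial>M) = (\<integral>x. g x * g x \<partial>M)"
    using assms by (intro integral_cong_AE) (auto simp: ae_eq_def)
  then show ?thesis
    by (simp add: L2_norm_def L2_inner_def)
qed

lemma L2_inner_tendsto:
  assumes F: "\<And>n. F n \<in> L2 M" and f: "f \<in> L2 M" and g: "g \<in> L2 M"
    and lim: "(\<lambda>n. L2_norm M (\<lambda>x. f x - F n x)) \<longlonglongrightarrow> 0"
  shows "(\<lambda>n. L2_inner M (F n) g) \<longlonglongrightarrow> L2_inner M f g"
proof -
  have "(\<lambda>n. L2_inner M f g - L2_inner M (F n) g) \<longlonglongrightarrow> 0"
  proof (rule Lim_null_comparison)
    have "norm (L2_inner M f g - L2_inner M (F n) g) \<le> L2_norm M (\<lambda>x. f x - F n x) * L2_norm M g"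
      for n
      using L2_Cauchy_Schwarz[OF L2_diff[OF f F] g] by (simp add: L2_inner_diff_left f F g)
    then show "\<forall>\<^sub>F n in sequentially.
        norm (L2_inner M f g - L2_inner M (F n) g) \<le> L2_norm M (\<lambda>x. f x - F n x) * L2_norm M g"
      by simp
    show "(\<lambda>n. L2_norm M (\<lambda>x. f x - F n x) * L2_norm M g) \<longlonglongrightarrow> 0"
      using tendsto_mult_right[OF lim, of "L2_norm M g"] by simp
  qed
  from tendsto_diff[OF tendsto_const[of "L2_inner M f g"] this] show ?thesis by simp
qed

lemma nn_integral_square_L2:
  assumes "f \<in> L2 M"
  shows "(\<integral>\<^sup>+x. ennreal ((f x)\<^sup>2) \<partial>M) = ennreal (L2_inner M f f)"
  using assms nn_integral_eq_integral[OF L2_square_integrable[OF assms]]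
  by (simp add: L2_inner_def power2_eq_square)

text \<open>
  The Riesz-Fischer theorem. Along a subsequence whose increments \<open>g\<^sub>k\<close> have norm at most
  \<open>2\<^sup>-\<^sup>k\<close>, the function \<open>\<Sum>k. 2\<^sup>k * g\<^sub>k\<^sup>2\<close> has finite integral, hence is finite almost
  everywhere; since \<open>\<bar>g\<^sub>k\<bar> \<le> 2\<^sup>-\<^sup>k + 2\<^sup>k * g\<^sub>k\<^sup>2\<close>, the subsequence converges almost everywhere.
  Fatou's lemma turns pointwise convergence of the subsequence into norm convergence of the whole
  sequence.
\<close>

lemma L2_complete:
  assumes F: "\<And>n::nat. F n \<in> L2 M"
    and Cauchy: "\<And>\<epsilon>. 0 < \<epsilon> \<Longrightarrow> \<exists>n0. \<forall>m\<ge>n0. \<forall>n\<ge>n0. L2_norm M (\<lambda>x. F m x - F n x) < \<epsilon>"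
  obtains f where "f \<in> L2 M" and "(\<lambda>n. L2_norm M (\<lambda>x. F n x - f x)) \<longlonglongrightarrow> 0"
proof -
  have [measurable]: "F n \<in> borel_measurable M" for n
    using F by (rule L2_measurable)
  have "\<forall>k. \<exists>n0. \<forall>m\<ge>n0. \<forall>n\<ge>n0. L2_norm M (\<lambda>x. F m x - F n x) < (1/2)^k"
    using Cauchy by simp
  then obtain r0 where r0:
    "\<And>k m n. r0 k \<le> m \<Longrightarrow> r0 k \<le> n \<Longrightarrow> L2_norm M (\<lambda>x. F m x - F n x) < (1/2)^k"
    by metis
  \<comment> \<open>Any monotone sequence above \<open>r0\<close> that tends to infinity serves as the subsequence.\<close>
  define r where "r k = (\<Sum>i\<le>k. r0 i) + k" for k
  have r0_le: "r0 k \<le> r k" for k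
    unfolding r_def by (induction k) auto
  have "r k \<le> r (Suc k)" for k
    unfolding r_def by simp
  then have r_mono: "r k \<le> r l" if "k \<le> l" for k l
    using lift_Suc_mono_le that by blast
  have r_ge: "k \<le> r k" for k
    by (simp add: r_def)
  define g where "g k x = F (r (Suc k)) x - F (r k) x" for k x
  have [measurable]: "g k \<in> borel_measurable M" for k
    unfolding g_def by measurable
  have g_L2: "g k \<in> L2 M" for k
    unfolding g_def by (intro L2_diff F)
  have g_norm: "L2_inner M (g k) (g k) \<le> (1/4)^k" for k
  proof -
    have "L2_norm M (g k) \<le> (1/2)^k"
      unfolding g_def
      by (intro less_imp_le r0 order_trans[OF r0_le r_mono] r0_le) simp_all
    then have "(L2_norm M (g k))\<^sup>2 \<le> ((1/2)^k)\<^sup>2"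
      by (intro power_mono) simp_all
    also have "((1/2)^k)\<^sup>2 = (1/4::real)^k"
      by (simp flip: power_mult_distrib add: power2_eq_square)
    finally show ?thesis by (simp add: L2_norm_square)
  qed
  have "(\<integral>\<^sup>+x. (\<Sum>k. ennreal (2^k * (g k x)\<^sup>2)) \<partial>M) = (\<Sum>k. \<integral>\<^sup>+x. ennreal (2^k * (g k x)\<^sup>2) \<partial>M)"
    by (intro nn_integral_suminf) measurable
  also have "\<dots> = (\<Sum>k. ennreal (2^k * L2_inner M (g k) (g k)))"
    by (simp add: ennreal_mult nn_integral_cmult nn_integral_square_L2[OF g_L2])
  also have "\<dots> \<le> (\<Sum>k. ennreal ((1/2)^k))"
  proof (intro suminf_le ennreal_leI)
    show "2^k * L2_inner M (g k) (g k) \<le> (1/2)^k" for k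
    proof -
      have "2^k * L2_inner M (g k) (g k) \<le> 2^k * (1/4)^k"
        using g_norm by (intro mult_left_mono) auto
      also have "\<dots> = (1/2)^k" by (simp flip: power_mult_distrib)
      finally show ?thesis .
    qed
  qed simp_all
  also have "\<dots> = ennreal (\<Sum>k. (1/2)^k)"
    by (intro suminf_ennreal2) auto
  finally have "(\<integral>\<^sup>+x. (\<Sum>k. ennreal (2^k * (g k x)\<^sup>2)) \<partial>M) \<noteq> \<infinity>"
    by (auto simp: top_unique)
  then have "AE x in M. (\<Sum>k. ennreal (2^k * (g k x)\<^sup>2)) \<noteq> \<infinity>"
    by (intro nn_integral_PInf_AE) measurable
  then have AE_conv: "AE x in M. convergent (\<lambda>k. F (r k) x)"
  proof (eventually_elim)
    case (elim x)
    have sq: "summable (\<lambda>k. 2^k * (g k x)\<^sup>2)"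
      using elim by (intro summable_suminf_not_top) auto
    have "summable (\<lambda>k. g k x)"
    proof (rule summable_comparison_test'[OF summable_add[OF summable_geometric sq]])
      show "norm (1/2 :: real) < 1" by simp
      show "norm (g k x) \<le> (1/2)^k + 2^k * (g k x)\<^sup>2" for k
      proof (cases "\<bar>g k x\<bar> \<le> (1/2)^k")
        case True
        then show ?thesis by (simp add: add_increasing2)
      next
        case False
        then have "1 \<le> 2^k * \<bar>g k x\<bar>" by (simp add: power_one_over field_simps)
        then have "1 * \<bar>g k x\<bar> \<le> 2^k * \<bar>g k x\<bar> * \<bar>g k x\<bar>"
          by (rule mult_right_mono) simp
        then show ?thesis
          by (simp add: power2_eq_square mult.assoc abs_mult[symmetric] add_increasing)
      qed
    qed
    then have "convergent (\<lambda>n. F (r 0) x + (\<Sum>k<n. g k x))"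
      by (intro convergent_add convergent_const) (simp add: summable_iff_convergent)
    moreover have "F (r 0) x + (\<Sum>k<n. g k x) = F (r n) x" for n
      by (induction n) (auto simp: g_def)
    ultimately show ?case by simp
  qed
  define f where "f x = lim (\<lambda>k. F (r k) x)" for x
  have [measurable]: "f \<in> borel_measurable M"
    unfolding f_def by measurable
  have limit: "AE x in M. (\<lambda>k. F (r k) x) \<longlonglongrightarrow> f x"
    using AE_conv by (auto simp: f_def convergent_LIMSEQ_iff)
  have bound: "(\<integral>\<^sup>+x. ennreal ((F n x - f x)\<^sup>2) \<partial>M) \<le> ennreal (((1/2)^k)\<^sup>2)" if n: "r0 k \<le> n" for n k
  proof -
    have "(\<integral>\<^sup>+x. ennreal ((F n x - f x)\<^sup>2) \<partial>M) = (\<integral>\<^sup>+x. liminf (\<lambda>j. ennreal ((F n x - F (r j) x)\<^sup>2)) \<partial>M)"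
    proof (rule nn_integral_cong_AE)
      show "AE x in M. ennreal ((F n x - f x)\<^sup>2) = liminf (\<lambda>j. ennreal ((F n x - F (r j) x)\<^sup>2))"
        using limit
      proof (eventually_elim)
        case (elim x)
        then have "(\<lambda>j. ennreal ((F n x - F (r j) x)\<^sup>2)) \<longlonglongrightarrow> ennreal ((F n x - f x)\<^sup>2)"
          by (intro tendsto_intros)
        then show ?case
          by (intro lim_imp_Liminf[symmetric]) simp_all
      qed
    qed
    also have "\<dots> \<le> liminf (\<lambda>j. \<integral>\<^sup>+x. ennreal ((F n x - F (r j) x)\<^sup>2) \<partial>M)"
      by (intro nn_integral_liminf) measurable
    also have "\<dots> \<le> ennreal (((1/2)^k)\<^sup>2)"
    proof (rule Liminf_le)
      show "\<forall>\<^sub>F j in sequentially. (\<integral>\<^sup>+x. ennreal ((F n x - F (r j) x)\<^sup>2) \<partial>M) \<le> ennreal (((1/2)^k)\<^sup>2)"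
        using eventually_ge_at_top[of "r0 k"]
      proof (eventually_elim)
        case (elim j)
        have "(L2_norm M (\<lambda>x. F n x - F (r j) x))\<^sup>2 \<le> ((1/2)^k)\<^sup>2"
          using n elim r_ge[of j] by (intro power_mono less_imp_le[OF r0]) auto
        then show ?case
          by (simp add: nn_integral_square_L2[OF L2_diff[OF F F]] L2_norm_square ennreal_leI)
      qed
    qed simp
    finally show ?thesis .
  qed
  have diff_L2: "(\<lambda>x. F n x - f x) \<in> L2 M" if "r0 k \<le> n" for n k
  proof -
    have "(\<integral>\<^sup>+x. ennreal (norm ((F n x - f x)\<^sup>2)) \<partial>M) < \<infinity>"
      using bound[OF that] by (simp add: order.strict_trans1)
    then have "integrable M (\<lambda>x. (F n x - f x)\<^sup>2)"
      by (intro integrableI_bounded) measurable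
    then show ?thesis by (simp add: L2_def)
  qed
  have f_L2: "f \<in> L2 M"
    using L2_diff[OF F diff_L2[of 0 "r0 0"], of "r0 0"] by simp
  have small: "L2_norm M (\<lambda>x. F n x - f x) \<le> (1/2)^k" if "r0 k \<le> n" for n k
  proof -
    have "ennreal ((L2_norm M (\<lambda>x. F n x - f x))\<^sup>2) \<le> ennreal (((1/2)^k)\<^sup>2)"
      using bound[OF that] nn_integral_square_L2[OF diff_L2[OF that]] by (simp add: L2_norm_square)
    then show ?thesis
      by (auto simp: intro: power2_le_imp_le)
  qed
  have "(\<lambda>n. L2_norm M (\<lambda>x. F n x - f x)) \<longlonglongrightarrow> 0"
  proof (rule LIMSEQ_I)
    fix \<epsilon> :: real assume "0 < \<epsilon>"
    then obtain k where k: "(1/2)^k < \<epsilon>"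
      using real_arch_pow_inv[of \<epsilon> "1/2"] by auto
    show "\<exists>n0. \<forall>n\<ge>n0. norm (L2_norm M (\<lambda>x. F n x - f x) - 0) < \<epsilon>"
      using small k by (intro exI[of _ "r0 k"]) (auto intro: order.strict_trans1)
  qed
  with f_L2 show ?thesis by (rule that)
qed

section \<open>Orthonormal sequences\<close>

locale orthonormal_sequence =
  fixes M :: "'a measure" and \<phi> :: "nat \<Rightarrow> 'a \<Rightarrow> real"
  assumes basis_L2: "\<phi> k \<in> L2 M"
    and basis_inner: "L2_inner M (\<phi> k) (\<phi> l) = (if k = l then 1 else 0)"
begin

lemma combination_L2: "(\<lambda>x. \<Sum>k\<in>I. c k * \<phi> k x) \<in> L2 M"
  by (intro L2_sum L2_scale basis_L2)

lemma inner_combination_left: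
  assumes "f \<in> L2 M"
  shows "L2_inner M (\<lambda>x. \<Sum>k\<in>I. c k * \<phi> k x) f = (\<Sum>k\<in>I. c k * L2_inner M f (\<phi> k))"
  using assms
  by (subst L2_inner_sum_left)
    (auto intro: L2_scale basis_L2 simp: L2_inner_scale_left L2_inner_commute[of M f])

lemma coefficient_of_combination:
  assumes "finite I"
  shows "L2_inner M (\<lambda>x. \<Sum>k\<in>I. c k * \<phi> k x) (\<phi> l) = (if l \<in> I then c l else 0)"
  using assms by (simp add: inner_combination_left basis_L2 basis_inner if_distrib cong: if_cong)

lemma inner_combination_self:
  assumes "finite I"
  shows "L2_inner M (\<lambda>x. \<Sum>k\<in>I. c k * \<phi> k x) (\<lambda>x. \<Sum>k\<in>I. c k * \<phi> k x) = (\<Sum>k\<in>I. (c k)\<^sup>2)"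
  using assms
  by (simp add: inner_combination_left[OF combination_L2] coefficient_of_combination power2_eq_square)

text \<open>
  Completing the square: the coefficients of the combination enter only through their distance from
  the Fourier coefficients. Both Bessel's and Parseval's inequalities are read off from this identity.
\<close>

lemma norm_diff_combination_square:
  assumes f: "f \<in> L2 M"
  shows "(L2_norm M (\<lambda>x. f x - (\<Sum>k<n. c k * \<phi> k x)))\<^sup>2
    = L2_inner M f f - (\<Sum>k<n. (L2_inner M f (\<phi> k))\<^sup>2) + (\<Sum>k<n. (L2_inner M f (\<phi> k) - c k)\<^sup>2)"
proof -
  have "(L2_norm M (\<lambda>x. f x - (\<Sum>k<n. c k * \<phi> k x)))\<^sup>2
    = L2_inner M f f - 2 * (\<Sum>k<n. c k * L2_inner M f (\<phi> k)) + (\<Sum>k<n. (c k)\<^sup>2)"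
    using L2_norm_diff_square[OF f combination_L2[of c "{..<n}"]] inner_combination_left[OF f, of c "{..<n}"]
      L2_inner_commute[of M f "\<lambda>x. \<Sum>k<n. c k * \<phi> k x"]
    by (simp add: inner_combination_self)
  then show ?thesis
    by (simp add: power2_diff sum.distrib sum_subtractf sum_distrib_left mult.assoc mult.commute
        mult.left_commute)
qed

lemma Bessel_partial:
  assumes "f \<in> L2 M"
  shows "(\<Sum>k<n. (L2_inner M f (\<phi> k))\<^sup>2) \<le> L2_inner M f f"
  using norm_diff_combination_square[OF assms, where n = n and c = "\<lambda>k. L2_inner M f (\<phi> k)"]
    zero_le_power2[of "L2_norm M (\<lambda>x. f x - (\<Sum>k<n. L2_inner M f (\<phi> k) * \<phi> k x))"]
  by simp

lemma Bessel_summable: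
  assumes "f \<in> L2 M"
  shows "summable (\<lambda>k. (L2_inner M f (\<phi> k))\<^sup>2)"
  using Bessel_partial[OF assms] by (intro summableI_nonneg_bounded) auto

lemma Bessel:
  assumes "f \<in> L2 M"
  shows "(\<Sum>k. (L2_inner M f (\<phi> k))\<^sup>2) \<le> L2_inner M f f"
  using Bessel_partial[OF assms] Bessel_summable[OF assms] by (intro suminf_le_const) auto

lemma closed_span_L2: "f \<in> closed_span M \<phi> \<Longrightarrow> f \<in> L2 M"
  by (simp add: closed_span_def)

text \<open>
  Together with Bessel's inequality this is Parseval's identity. Among all combinations, the one with
  the Fourier coefficients has the smallest error, so any approximating combination bounds the defect
  in Bessel's inequality.
\<close>

lemma Parseval:
  assumes f: "f \<in> closed_span M \<phi>"
  shows "L2_inner M f f \<le> (\<Sum>k. (L2_inner M f (\<phi> k))\<^sup>2)"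
proof (rule field_le_epsilon)
  fix e :: real assume e: "0 < e"
  have fL: "f \<in> L2 M" using f by (rule closed_span_L2)
  obtain n c where "L2_norm M (\<lambda>x. f x - (\<Sum>k<n. c k * \<phi> k x)) < sqrt e"
    using f e unfolding closed_span_def by (auto dest!: spec[of _ "sqrt e"])
  then have "(L2_norm M (\<lambda>x. f x - (\<Sum>k<n. c k * \<phi> k x)))\<^sup>2 \<le> (sqrt e)\<^sup>2"
    by (intro power_mono) auto
  then have "L2_inner M f f - (\<Sum>k<n. (L2_inner M f (\<phi> k))\<^sup>2) + (\<Sum>k<n. (L2_inner M f (\<phi> k) - c k)\<^sup>2) \<le> e"
    using e by (simp add: norm_diff_combination_square[OF fL])
  moreover have "0 \<le> (\<Sum>k<n. (L2_inner M f (\<phi> k) - c k)\<^sup>2)"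
    by (intro sum_nonneg) simp
  moreover have "(\<Sum>k<n. (L2_inner M f (\<phi> k))\<^sup>2) \<le> (\<Sum>k. (L2_inner M f (\<phi> k))\<^sup>2)"
    by (intro sum_le_suminf Bessel_summable fL) auto
  ultimately show "L2_inner M f f \<le> (\<Sum>k. (L2_inner M f (\<phi> k))\<^sup>2) + e"
    by linarith
qed

lemma closed_span_zero: "(\<lambda>_. 0) \<in> closed_span M \<phi>"
proof -
  have "L2_norm M (\<lambda>x. 0 - (\<Sum>k<(0::nat). 0 * \<phi> k x)) = 0"
    by (simp add: L2_norm_def)
  then show ?thesis
    unfolding closed_span_def by (auto intro!: exI[of _ "0::nat"] simp: L2_norm_def)
qed

text \<open>
  The combinations that witness membership in the closed span may vary with the tolerance. They can be
  replaced by the partial sums of one series, so that sums and multiples of members are handled by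
  adding and scaling coefficients.
\<close>

lemma expansion_tendsto:
  assumes f: "f \<in> closed_span M \<phi>"
  shows "(\<lambda>n. L2_norm M (\<lambda>x. f x - (\<Sum>k<n. L2_inner M f (\<phi> k) * \<phi> k x))) \<longlonglongrightarrow> 0"
proof -
  have fL: "f \<in> L2 M" using f by (rule closed_span_L2)
  have "(\<lambda>n. \<Sum>k<n. (L2_inner M f (\<phi> k))\<^sup>2) \<longlonglongrightarrow> L2_inner M f f"
    using summable_LIMSEQ[OF Bessel_summable[OF fL]] Parseval[OF f] Bessel[OF fL]
    by (metis order.antisym)
  then have "(\<lambda>n. sqrt (L2_inner M f f - (\<Sum>k<n. (L2_inner M f (\<phi> k))\<^sup>2))) \<longlonglongrightarrow> sqrt (L2_inner M f f - L2_inner M f f)"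
    by (intro tendsto_intros)
  moreover have "L2_norm M (\<lambda>x. f x - (\<Sum>k<n. L2_inner M f (\<phi> k) * \<phi> k x))
      = sqrt (L2_inner M f f - (\<Sum>k<n. (L2_inner M f (\<phi> k))\<^sup>2))" for n
    by (rule real_sqrt_unique[symmetric])
      (simp_all add: norm_diff_combination_square[OF fL])
  ultimately show ?thesis by simp
qed

lemma closed_spanI:
  assumes "f \<in> L2 M" and "(\<lambda>n. L2_norm M (\<lambda>x. f x - (\<Sum>k<n. c k * \<phi> k x))) \<longlonglongrightarrow> 0"
  shows "f \<in> closed_span M \<phi>"
  unfolding closed_span_def
proof (intro CollectI conjI allI impI)
  fix \<epsilon> :: real assume "0 < \<epsilon>"
  then have "\<forall>\<^sub>F n in sequentially. L2_norm M (\<lambda>x. f x - (\<Sum>k<n. c k * \<phi> k x)) < \<epsilon>"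
    using assms(2) by (rule order_tendstoD(2)[rotated])
  then show "\<exists>n c. L2_norm M (\<lambda>x. f x - (\<Sum>k<n. c k * \<phi> k x)) < \<epsilon>"
    using eventually_happens'[OF sequentially_bot] by blast
qed (fact assms(1))

lemma closed_span_ae_eq:
  assumes f: "f \<in> closed_span M \<phi>" and g: "g \<in> borel_measurable M" and eq: "ae_eq M f g"
  shows "g \<in> closed_span M \<phi>"
proof -
  have fL: "f \<in> L2 M" using f by (rule closed_span_L2)
  have "L2_norm M (\<lambda>x. g x - (\<Sum>k<n. c k * \<phi> k x)) = L2_norm M (\<lambda>x. f x - (\<Sum>k<n. c k * \<phi> k x))"
    for n and c :: "nat \<Rightarrow> real"
    using fL g eq combination_L2[of c "{..<n}"]
    by (intro L2_norm_ae_eq borel_measurable_diff) (auto simp: ae_eq_def dest: L2_measurable)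
  then show ?thesis
    using f L2_ae_eq[OF fL g eq] by (simp add: closed_span_def)
qed

lemma closed_span_scale:
  assumes f: "f \<in> closed_span M \<phi>"
  shows "(\<lambda>x. d * f x) \<in> closed_span M \<phi>"
proof (rule closed_spanI)
  show "(\<lambda>x. d * f x) \<in> L2 M"
    by (intro L2_scale closed_span_L2 f)
  have "L2_norm M (\<lambda>x. d * f x - (\<Sum>k<n. d * L2_inner M f (\<phi> k) * \<phi> k x))
      = \<bar>d\<bar> * L2_norm M (\<lambda>x. f x - (\<Sum>k<n. L2_inner M f (\<phi> k) * \<phi> k x))" for n
    by (subst L2_norm_scale[symmetric]) (simp add: right_diff_distrib sum_distrib_left mult.assoc)
  then show "(\<lambda>n. L2_norm M (\<lambda>x. d * f x - (\<Sum>k<n. d * L2_inner M f (\<phi> k) * \<phi> k x))) \<longlonglongrightarrow> 0"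
    using tendsto_mult_left[OF expansion_tendsto[OF f], of "\<bar>d\<bar>"] by simp
qed

lemma closed_span_add:
  assumes f: "f \<in> closed_span M \<phi>" and g: "g \<in> closed_span M \<phi>"
  shows "(\<lambda>x. f x + g x) \<in> closed_span M \<phi>"
proof (rule closed_spanI)
  have fL: "f \<in> L2 M" and gL: "g \<in> L2 M" using f g by (auto intro: closed_span_L2)
  then show "(\<lambda>x. f x + g x) \<in> L2 M" by (rule L2_add)
  let ?r = "\<lambda>f n x. f x - (\<Sum>k<n. L2_inner M f (\<phi> k) * \<phi> k x)"
  let ?c = "\<lambda>k. L2_inner M f (\<phi> k) + L2_inner M g (\<phi> k)"
  show "(\<lambda>n. L2_norm M (\<lambda>x. f x + g x - (\<Sum>k<n. ?c k * \<phi> k x))) \<longlonglongrightarrow> 0"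
  proof (rule Lim_null_comparison)
    have "L2_norm M (\<lambda>x. f x + g x - (\<Sum>k<n. ?c k * \<phi> k x)) \<le> L2_norm M (?r f n) + L2_norm M (?r g n)"
      for n
    proof -
      have "(\<lambda>x. f x + g x - (\<Sum>k<n. ?c k * \<phi> k x)) = (\<lambda>x. ?r f n x + ?r g n x)"
        by (simp add: fun_eq_iff distrib_right sum.distrib)
      then show ?thesis
        using L2_norm_triangle[OF L2_diff[OF fL combination_L2] L2_diff[OF gL combination_L2]] by simp
    qed
    then show "\<forall>\<^sub>F n in sequentially. norm (L2_norm M (\<lambda>x. f x + g x - (\<Sum>k<n. ?c k * \<phi> k x)))
        \<le> L2_norm M (?r f n) + L2_norm M (?r g n)"
      by simp
    show "(\<lambda>n. L2_norm M (?r f n) + L2_norm M (?r g n)) \<longlonglongrightarrow> 0"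
      using tendsto_add[OF expansion_tendsto[OF f] expansion_tendsto[OF g]] by simp
  qed
qed

lemma closed_span_diff:
  assumes "f \<in> closed_span M \<phi>" and "g \<in> closed_span M \<phi>"
  shows "(\<lambda>x. f x - g x) \<in> closed_span M \<phi>"
  using closed_span_add[OF assms(1) closed_span_scale[OF assms(2), of "-1"]] by simp

text \<open>
  This is where the restriction to the closed span matters: it excludes the nonzero functions orthogonal
  to the whole system, and thereby makes the parameter function unique.
\<close>

lemma closed_span_coefficients_inject:
  assumes f: "f \<in> closed_span M \<phi>" and g: "g \<in> closed_span M \<phi>"
    and eq: "\<And>k. L2_inner M f (\<phi> k) = L2_inner M g (\<phi> k)"
  shows "ae_eq M f g"
proof -
  have h: "(\<lambda>x. f x - g x) \<in> closed_span M \<phi>"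
    using f g by (rule closed_span_diff)
  have "L2_inner M (\<lambda>x. f x - g x) (\<phi> k) = 0" for k
    using eq[of k] by (simp add: L2_inner_diff_left closed_span_L2 f g basis_L2)
  then have "L2_inner M (\<lambda>x. f x - g x) (\<lambda>x. f x - g x) \<le> 0"
    using Parseval[OF h] by simp
  then have "L2_inner M (\<lambda>x. f x - g x) (\<lambda>x. f x - g x) = 0"
    by (intro antisym) auto
  then show ?thesis
    by (simp add: L2_inner_self_eq_0_iff[OF closed_span_L2[OF h]]) (simp add: ae_eq_def)
qed

text \<open>Orthonormality turns the Cauchy criterion for \<open>\<Sum>k. (c k)\<^sup>2\<close> into the one in norm.\<close>

lemma Riesz_Fischer:
  assumes c: "summable (\<lambda>k. (c k)\<^sup>2)"
  obtains f where "f \<in> closed_span M \<phi>" and "\<And>k. L2_inner M f (\<phi> k) = c k"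
proof -
  define S where "S n x = (\<Sum>k<n. c k * \<phi> k x)" for n :: nat and x
  have S_L2: "S n \<in> L2 M" for n
    unfolding S_def by (rule combination_L2)
  have increment: "L2_norm M (\<lambda>x. S m x - S n x) = sqrt (\<Sum>k=n..<m. (c k)\<^sup>2)" if "n \<le> m" for m n
  proof -
    have "(\<lambda>x. S m x - S n x) = (\<lambda>x. \<Sum>k=n..<m. c k * \<phi> k x)"
      using that by (simp add: S_def fun_eq_iff sum_diff_nat_ivl lessThan_atLeast0)
    then show ?thesis
      by (simp add: L2_norm_def inner_combination_self)
  qed
  have Cauchy: "\<exists>n0. \<forall>m\<ge>n0. \<forall>n\<ge>n0. L2_norm M (\<lambda>x. S m x - S n x) < \<epsilon>" if \<epsilon>: "0 < \<epsilon>" for \<epsilon>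
  proof -
    obtain n0 where n0: "\<And>m n. n0 \<le> m \<Longrightarrow> norm (\<Sum>k=m..<n. (c k)\<^sup>2) < \<epsilon>\<^sup>2"
      using c \<epsilon> unfolding summable_Cauchy by (meson zero_less_power)
    have "L2_norm M (\<lambda>x. S m x - S n x) < \<epsilon>" if "n \<le> m" "n0 \<le> n" for m n
    proof -
      have "sqrt (\<Sum>k=n..<m. (c k)\<^sup>2) < sqrt (\<epsilon>\<^sup>2)"
        using n0[OF that(2), of m] by (intro real_sqrt_less_mono) simp
      then show ?thesis using \<epsilon> by (simp add: increment[OF that(1)])
    qed
    then show ?thesis
      by (metis L2_norm_diff_commute nle_le)
  qed
  obtain f where f: "f \<in> L2 M" and lim: "(\<lambda>n. L2_norm M (\<lambda>x. S n x - f x)) \<longlonglongrightarrow> 0"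
    using L2_complete[OF S_L2 Cauchy] by blast
  then have lim': "(\<lambda>n. L2_norm M (\<lambda>x. f x - S n x)) \<longlonglongrightarrow> 0"
    using L2_norm_diff_commute[of M f] by simp
  show ?thesis
  proof (rule that)
    show "f \<in> closed_span M \<phi>"
      using f lim' unfolding S_def by (rule closed_spanI)
    show "L2_inner M f (\<phi> k) = c k" for k
    proof (rule LIMSEQ_unique[OF L2_inner_tendsto[OF S_L2 f basis_L2 lim']])
      have "\<forall>\<^sub>F n in sequentially. L2_inner M (S n) (\<phi> k) = c k"
        using eventually_gt_at_top[of k]
        by eventually_elim (simp add: S_def[abs_def] coefficient_of_combination)
      then show "(\<lambda>n. L2_inner M (S n) (\<phi> k)) \<longlonglongrightarrow> c k"
        by (rule tendsto_eventually)
    qed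
  qed
qed

end

section \<open>The reproducing kernel Hilbert space\<close>

locale weighted_orthonormal_sequence = orthonormal_sequence M \<phi>
  for M :: "'a measure" and \<phi> :: "nat \<Rightarrow> 'a \<Rightarrow> real" +
  fixes lam :: "nat \<Rightarrow> real"
  assumes weight_pos: "0 < lam k"
    and weight_bounded: "bdd_above (range lam)"
begin

lemma H_space_closed_span: "f \<in> H_space M \<phi> lam \<Longrightarrow> f \<in> closed_span M \<phi>"
  and H_space_summable: "f \<in> H_space M \<phi> lam \<Longrightarrow> summable (\<lambda>k. (L2_inner M f (\<phi> k))\<^sup>2 / lam k)"
  by (auto simp: H_space_def)

lemma H_space_L2: "f \<in> H_space M \<phi> lam \<Longrightarrow> f \<in> L2 M"
  by (intro closed_span_L2 H_space_closed_span)

lemma weighted_product_le: "\<bar>s * t / lam k\<bar> \<le> s\<^sup>2 / lam k + t\<^sup>2 / lam k"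
  using divide_right_mono[OF abs_mult_le_sum_squares[of s t], of "lam k"] weight_pos[of k]
  by (simp add: add_divide_distrib abs_mult)

lemma weighted_product_summable:
  assumes "summable (\<lambda>k. (s k)\<^sup>2 / lam k)" and "summable (\<lambda>k. (t k)\<^sup>2 / lam k)"
  shows "summable (\<lambda>k. s k * t k / lam k)"
  by (rule summable_comparison_test'[OF summable_add[OF assms]]) (simp only: real_norm_def weighted_product_le)

lemma H_product_summable:
  assumes "f \<in> H_space M \<phi> lam" and "g \<in> H_space M \<phi> lam"
  shows "summable (\<lambda>k. L2_inner M f (\<phi> k) * L2_inner M g (\<phi> k) / lam k)"
  using assms by (intro weighted_product_summable H_space_summable)

text \<open>
  Bounded weights make the weighted norm dominate the \<open>L\<^sup>2\<close> norm, so every coefficient sequence of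
  finite weighted norm belongs to a function.
\<close>

lemma H_space_coefficients_surj:
  assumes c: "summable (\<lambda>k. (c k)\<^sup>2 / lam k)"
  obtains f where "f \<in> H_space M \<phi> lam" and "\<And>k. L2_inner M f (\<phi> k) = c k"
proof -
  obtain B where B: "\<And>k. lam k \<le> B"
    using weight_bounded by (auto simp: bdd_above_def)
  have "summable (\<lambda>k. (c k)\<^sup>2)"
  proof (rule summable_comparison_test'[OF summable_mult[OF c, of B]])
    show "norm ((c k)\<^sup>2) \<le> B * ((c k)\<^sup>2 / lam k)" for k
      using mult_right_mono[OF B[of k], of "(c k)\<^sup>2 / lam k"] weight_pos[of k] by simp
  qed
  from Riesz_Fischer[OF this] obtain f
    where f: "f \<in> closed_span M \<phi>" and fc: "\<And>k. L2_inner M f (\<phi> k) = c k" by blast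
  have "f \<in> H_space M \<phi> lam"
    using f c by (simp add: H_space_def fc)
  then show ?thesis using fc by (rule that)
qed

lemma H_space_zero: "(\<lambda>_. 0) \<in> H_space M \<phi> lam"
  by (simp add: H_space_def closed_span_zero)

lemma H_space_scale: "f \<in> H_space M \<phi> lam \<Longrightarrow> (\<lambda>x. d * f x) \<in> H_space M \<phi> lam"
  using summable_mult[of "\<lambda>k. (L2_inner M f (\<phi> k))\<^sup>2 / lam k" "d\<^sup>2"]
  by (simp add: H_space_def closed_span_scale L2_inner_scale_left power_mult_distrib)

lemma H_space_add:
  assumes f: "f \<in> H_space M \<phi> lam" and g: "g \<in> H_space M \<phi> lam"
  shows "(\<lambda>x. f x + g x) \<in> H_space M \<phi> lam"
proof -
  have "summable (\<lambda>k. (L2_inner M f (\<phi> k))\<^sup>2 / lam k + 2 * (L2_inner M f (\<phi> k) * L2_inner M g (\<phi> k) / lam k)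
      + (L2_inner M g (\<phi> k))\<^sup>2 / lam k)"
    using f g by (intro summable_add summable_mult H_product_summable H_space_summable)
  moreover have "(L2_inner M (\<lambda>x. f x + g x) (\<phi> k))\<^sup>2 / lam k
      = (L2_inner M f (\<phi> k))\<^sup>2 / lam k + 2 * (L2_inner M f (\<phi> k) * L2_inner M g (\<phi> k) / lam k)
      + (L2_inner M g (\<phi> k))\<^sup>2 / lam k" for k
    by (simp add: L2_inner_add_left H_space_L2 f g basis_L2 power2_sum add_divide_distrib mult.assoc)
  ultimately show ?thesis
    using closed_span_add[OF H_space_closed_span[OF f] H_space_closed_span[OF g]]
    by (simp add: H_space_def)
qed

lemma H_space_diff:
  assumes "f \<in> H_space M \<phi> lam" and "g \<in> H_space M \<phi> lam"
  shows "(\<lambda>x. f x - g x) \<in> H_space M \<phi> lam"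
  using H_space_add[OF assms(1) H_space_scale[OF assms(2), of "-1"]] by simp

lemma H_space_ae_eq:
  assumes f: "f \<in> H_space M \<phi> lam" and g: "g \<in> borel_measurable M" and eq: "ae_eq M f g"
  shows "g \<in> H_space M \<phi> lam" and "H_inner M \<phi> lam f h = H_inner M \<phi> lam g h"
proof -
  have "g \<in> L2 M"
    using H_space_L2[OF f] g eq by (rule L2_ae_eq)
  then have "L2_inner M f (\<phi> k) = L2_inner M g (\<phi> k)" for k
    using H_space_L2[OF f] eq by (intro L2_inner_ae_eq basis_L2)
  then show "g \<in> H_space M \<phi> lam" and "H_inner M \<phi> lam f h = H_inner M \<phi> lam g h"
    using f closed_span_ae_eq[OF H_space_closed_span[OF f] g eq]
    by (simp_all add: H_space_def H_inner_def)
qed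

lemma H_inner_self: "H_inner M \<phi> lam f f = (\<Sum>k. (L2_inner M f (\<phi> k) / sqrt (lam k))\<^sup>2)"
  using weight_pos by (simp add: H_inner_def power_divide power2_eq_square less_imp_le)

text \<open>
  Dividing the coefficients by \<open>sqrt (lam k)\<close> is an isometry onto the closed span, which carries the
  completeness of \<open>L\<^sup>2\<close> over to the weighted norm.
\<close>

lemma H_space_complete:
  assumes F: "\<And>n::nat. F n \<in> H_space M \<phi> lam"
    and Cauchy: "\<And>\<epsilon>. 0 < \<epsilon> \<Longrightarrow> \<exists>n0. \<forall>m\<ge>n0. \<forall>n\<ge>n0.
      sqrt (H_inner M \<phi> lam (\<lambda>x. F m x - F n x) (\<lambda>x. F m x - F n x)) < \<epsilon>"
  obtains f where "f \<in> H_space M \<phi> lam"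
    and "(\<lambda>n. sqrt (H_inner M \<phi> lam (\<lambda>x. F n x - f x) (\<lambda>x. F n x - f x))) \<longlonglongrightarrow> 0"
proof -
  have "\<exists>G. G \<in> closed_span M \<phi> \<and> (\<forall>k. L2_inner M G (\<phi> k) = L2_inner M (F n) (\<phi> k) / sqrt (lam k))" for n
  proof -
    have "summable (\<lambda>k. (L2_inner M (F n) (\<phi> k) / sqrt (lam k))\<^sup>2)"
      using H_space_summable[OF F] weight_pos by (simp add: power_divide less_imp_le)
    from Riesz_Fischer[OF this] show ?thesis by metis
  qed
  then obtain G where G: "\<And>n. G n \<in> closed_span M \<phi>"
    and GF: "\<And>n k. L2_inner M (G n) (\<phi> k) = L2_inner M (F n) (\<phi> k) / sqrt (lam k)"
    by metis
  have G_L2: "G n \<in> L2 M" for n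
    using G by (rule closed_span_L2)
  have coefficient_diff: "L2_inner M (\<lambda>x. G m x - G n x) (\<phi> k)
      = L2_inner M (\<lambda>x. F m x - F n x) (\<phi> k) / sqrt (lam k)" for m n k
    using G_L2 F by (simp add: L2_inner_diff_left H_space_L2 basis_L2 GF diff_divide_distrib)
  have norm_le: "L2_norm M (\<lambda>x. G m x - G n x)
      \<le> sqrt (H_inner M \<phi> lam (\<lambda>x. F m x - F n x) (\<lambda>x. F m x - F n x))" for m n
    unfolding L2_norm_def H_inner_self coefficient_diff[symmetric]
    by (intro real_sqrt_le_mono Parseval closed_span_diff G)
  have G_Cauchy: "\<exists>n0. \<forall>m\<ge>n0. \<forall>n\<ge>n0. L2_norm M (\<lambda>x. G m x - G n x) < \<epsilon>" if "0 < \<epsilon>" for \<epsilon>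
    using Cauchy[OF that] norm_le by (meson order.strict_trans1)
  obtain g where g: "g \<in> L2 M" and lim: "(\<lambda>n. L2_norm M (\<lambda>x. G n x - g x)) \<longlonglongrightarrow> 0"
    using L2_complete[OF G_L2 G_Cauchy] by blast
  have "summable (\<lambda>k. (sqrt (lam k) * L2_inner M g (\<phi> k))\<^sup>2 / lam k)"
    using Bessel_summable[OF g] weight_pos
    by (simp add: power_mult_distrib less_imp_le less_imp_neq[THEN not_sym])
  then obtain f where f: "f \<in> H_space M \<phi> lam"
    and fg: "\<And>k. L2_inner M f (\<phi> k) = sqrt (lam k) * L2_inner M g (\<phi> k)"
    by (rule H_space_coefficients_surj) blast
  have f_coefficient: "L2_inner M f (\<phi> k) / sqrt (lam k) = L2_inner M g (\<phi> k)" for k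
    using weight_pos[of k] by (simp add: fg)
  have coefficient_limit: "L2_inner M (\<lambda>x. F n x - f x) (\<phi> k) / sqrt (lam k)
      = L2_inner M (\<lambda>x. G n x - g x) (\<phi> k)" for n k
    using F f g G_L2 f_coefficient
    by (simp add: L2_inner_diff_left H_space_L2 basis_L2 GF diff_divide_distrib)
  have dist_le: "sqrt (H_inner M \<phi> lam (\<lambda>x. F n x - f x) (\<lambda>x. F n x - f x)) \<le> L2_norm M (\<lambda>x. G n x - g x)" for n
    unfolding L2_norm_def H_inner_self coefficient_limit
    by (intro real_sqrt_le_mono Bessel L2_diff G_L2 g)
  have dist_nonneg: "0 \<le> sqrt (H_inner M \<phi> lam h h)" if "h \<in> H_space M \<phi> lam" for h
    unfolding H_inner_self using H_space_summable[OF that] weight_pos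
    by (auto intro!: suminf_nonneg simp: power_divide less_imp_le)
  have "(\<lambda>n. sqrt (H_inner M \<phi> lam (\<lambda>x. F n x - f x) (\<lambda>x. F n x - f x))) \<longlonglongrightarrow> 0"
  proof (rule tendsto_sandwich[OF _ _ tendsto_const lim])
    show "\<forall>\<^sub>F n in sequentially. 0 \<le> sqrt (H_inner M \<phi> lam (\<lambda>x. F n x - f x) (\<lambda>x. F n x - f x))"
      using dist_nonneg H_space_diff[OF F f] by simp
    show "\<forall>\<^sub>F n in sequentially. sqrt (H_inner M \<phi> lam (\<lambda>x. F n x - f x) (\<lambda>x. F n x - f x))
        \<le> L2_norm M (\<lambda>x. G n x - g x)"
      using dist_le by simp
  qed
  with f show ?thesis by (rule that)
qed

theorem H_space_hilbert: "hilbert_space_ae M (H_space M \<phi> lam) (H_inner M \<phi> lam)"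
  unfolding hilbert_space_ae_def
proof (intro conjI ballI allI impI)
  show "H_space M \<phi> lam \<subseteq> borel_measurable M"
    using H_space_L2 L2_measurable by blast
  show "(\<lambda>_. 0) \<in> H_space M \<phi> lam" by (rule H_space_zero)
next
  fix f g assume f: "f \<in> H_space M \<phi> lam" and g: "g \<in> H_space M \<phi> lam"
  show "(\<lambda>x. f x + g x) \<in> H_space M \<phi> lam" using f g by (rule H_space_add)
  show "H_inner M \<phi> lam f g = H_inner M \<phi> lam g f" by (simp add: H_inner_def mult.commute)
  show "H_inner M \<phi> lam (\<lambda>x. c * f x) g = c * H_inner M \<phi> lam f g" for c
    unfolding H_inner_def
    by (subst suminf_mult[OF H_product_summable[OF f g], symmetric])
      (simp add: L2_inner_scale_left mult.assoc)
  fix h assume h: "h \<in> H_space M \<phi> lam"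
  show "H_inner M \<phi> lam (\<lambda>x. f x + g x) h = H_inner M \<phi> lam f h + H_inner M \<phi> lam g h"
    unfolding H_inner_def suminf_add[OF H_product_summable[OF f h] H_product_summable[OF g h]]
    by (simp add: L2_inner_add_left H_space_L2 f g basis_L2 distrib_right add_divide_distrib)
next
  fix f g assume f: "f \<in> H_space M \<phi> lam" and g: "g \<in> borel_measurable M" and eq: "ae_eq M f g"
  show "g \<in> H_space M \<phi> lam" using f g eq by (rule H_space_ae_eq)
  show "H_inner M \<phi> lam f h = H_inner M \<phi> lam g h" for h
    using f g eq by (rule H_space_ae_eq)
next
  fix f assume f: "f \<in> H_space M \<phi> lam"
  show "(\<lambda>x. c * f x) \<in> H_space M \<phi> lam" for c using f by (rule H_space_scale)
  have sq: "summable (\<lambda>k. (L2_inner M f (\<phi> k) / sqrt (lam k))\<^sup>2)"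
    using H_space_summable[OF f] weight_pos by (simp add: power_divide less_imp_le)
  show "0 \<le> H_inner M \<phi> lam f f"
    unfolding H_inner_self using sq by (rule suminf_nonneg) simp
  show "H_inner M \<phi> lam f f = 0 \<longleftrightarrow> ae_eq M f (\<lambda>_. 0)"
  proof
    assume "H_inner M \<phi> lam f f = 0"
    then have "\<forall>k. (L2_inner M f (\<phi> k) / sqrt (lam k))\<^sup>2 = 0"
      unfolding H_inner_self using suminf_eq_zero_iff[OF sq] by simp
    then have "L2_inner M f (\<phi> k) = L2_inner M (\<lambda>_. 0) (\<phi> k)" for k
      using weight_pos[of k] by (auto dest!: spec[of _ k])
    then show "ae_eq M f (\<lambda>_. 0)"
      using closed_span_coefficients_inject[OF H_space_closed_span[OF f] closed_span_zero] by blast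
  next
    assume "ae_eq M f (\<lambda>_. 0)"
    then have "L2_inner M f (\<phi> k) = 0" for k
      using L2_inner_ae_eq[OF H_space_L2[OF f] L2_zero basis_L2] by simp
    then show "H_inner M \<phi> lam f f = 0"
      by (simp add: H_inner_def)
  qed
next
  fix F assume F: "(\<forall>n. F n \<in> H_space M \<phi> lam) \<and> (\<forall>\<epsilon>>0. \<exists>n0::nat. \<forall>m\<ge>n0. \<forall>n\<ge>n0.
      sqrt (H_inner M \<phi> lam (\<lambda>x. F m x - F n x) (\<lambda>x. F m x - F n x)) < \<epsilon>)"
  obtain f where "f \<in> H_space M \<phi> lam"
    and "(\<lambda>n. sqrt (H_inner M \<phi> lam (\<lambda>x. F n x - f x) (\<lambda>x. F n x - f x))) \<longlonglongrightarrow> 0"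
    by (rule H_space_complete[OF conjunct1[OF F, rule_format] conjunct2[OF F, rule_format]])
  then show "\<exists>f\<in>H_space M \<phi> lam.
      (\<lambda>n. sqrt (H_inner M \<phi> lam (\<lambda>x. F n x - f x) (\<lambda>x. F n x - f x))) \<longlonglongrightarrow> 0"
    by blast
qed

end

section \<open>Mean-square series of orthogonal random variables\<close>

text \<open>
  Coefficients of a mean-square convergent series can be recovered from its sum, because the inner
  product with \<open>\<xi> k\<close> is continuous and is constant along the partial sums from \<open>n = k + 1\<close> on.
\<close>

lemma L2_series_coefficient:
  assumes \<xi>: "\<And>k. \<xi> k \<in> L2 P"
    and orthogonal: "\<And>k l. L2_inner P (\<xi> k) (\<xi> l) = (if k = l then lam k else 0)"
    and Y: "Y \<in> L2 P"
    and lim: "(\<lambda>n. L2_norm P (\<lambda>\<omega>. Y \<omega> - (\<Sum>k<n. c k * \<xi> k \<omega>))) \<longlonglongrightarrow> 0"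
  shows "L2_inner P Y (\<xi> k) = c k * lam k"
proof (rule LIMSEQ_unique[OF L2_inner_tendsto[OF _ Y \<xi> lim]])
  show "(\<lambda>\<omega>. \<Sum>k<n. c k * \<xi> k \<omega>) \<in> L2 P" for n
    by (intro L2_sum L2_scale \<xi>)
  have "L2_inner P (\<lambda>\<omega>. \<Sum>k<n. c k * \<xi> k \<omega>) (\<xi> k) = c k * lam k" if "k < n" for n
    using that
    by (subst L2_inner_sum_left)
      (auto simp: L2_inner_scale_left orthogonal if_distrib \<xi> intro: L2_scale cong: if_cong)
  then show "(\<lambda>n. L2_inner P (\<lambda>\<omega>. \<Sum>k<n. c k * \<xi> k \<omega>) (\<xi> k)) \<longlonglongrightarrow> c k * lam k"
    by (intro tendsto_eventually eventually_mono[OF eventually_gt_at_top[of k]])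
qed

text \<open>Bessel's inequality for the normalised variables \<open>\<xi> k / sqrt (lam k)\<close>.\<close>

lemma L2_orthogonal_coefficients_summable:
  assumes \<xi>: "\<And>k. \<xi> k \<in> L2 P"
    and orthogonal: "\<And>k l. L2_inner P (\<xi> k) (\<xi> l) = (if k = l then lam k else 0)"
    and pos: "\<And>k. 0 < lam k" and Y: "Y \<in> L2 P"
  shows "summable (\<lambda>k. (L2_inner P Y (\<xi> k))\<^sup>2 / lam k)"
proof -
  define \<psi> where "\<psi> k \<omega> = 1 / sqrt (lam k) * \<xi> k \<omega>" for k \<omega>
  have inner_\<psi>: "L2_inner P f (\<psi> k) = L2_inner P f (\<xi> k) / sqrt (lam k)" for f k
    unfolding \<psi>_def
    by (subst L2_inner_commute, subst L2_inner_scale_left, subst L2_inner_commute) simp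
  interpret orthonormal_sequence P \<psi>
  proof
    show "\<psi> k \<in> L2 P" for k
      unfolding \<psi>_def by (intro L2_scale \<xi>)
    show "L2_inner P (\<psi> k) (\<psi> l) = (if k = l then 1 else 0)" for k l
      using pos[of l] by (simp add: inner_\<psi> L2_inner_commute[of P "\<psi> k"] orthogonal)
  qed
  show ?thesis
    using Bessel_summable[OF Y] pos by (simp add: inner_\<psi> power_divide less_imp_le)
qed

section \<open>Second-order processes and their scores\<close>

text \<open>
  Square integrability on the product is what makes all uses of Fubini's theorem legitimate. Paths are
  in \<open>L\<^sup>2\<close> for every outcome, not only almost surely, so that an operator can be applied to each.
\<close>

locale square_integrable_process =
  P: prob_space P + N: sigma_finite_measure N
  for P :: "'w measure" and N :: "real measure" +
  fixes X :: "'w \<Rightarrow> real \<Rightarrow> real"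
  assumes process_L2: "(\<lambda>(\<omega>, u). X \<omega> u) \<in> L2 (P \<Otimes>\<^sub>M N)"
    and path_L2: "\<omega> \<in> space P \<Longrightarrow> X \<omega> \<in> L2 N"
    and mean_zero: "u \<in> space N \<Longrightarrow> (\<integral>\<omega>. X \<omega> u \<partial>P) = 0"
begin

sublocale PN: pair_sigma_finite P N ..

lemma L2_pair_product:
  assumes f: "f \<in> L2 P" and g: "g \<in> L2 N"
  shows "(\<lambda>(\<omega>, u). f \<omega> * g u) \<in> L2 (P \<Otimes>\<^sub>M N)"
proof -
  have [measurable]: "f \<in> borel_measurable P" "g \<in> borel_measurable N"
    using f g by (auto dest: L2_measurable)
  have "integrable (P \<Otimes>\<^sub>M N) (\<lambda>p. (f (fst p) * g (snd p))\<^sup>2)"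
  proof (rule PN.Fubini_integrable)
    show "integrable P (\<lambda>\<omega>. \<integral>u. norm ((f (fst (\<omega>, u)) * g (snd (\<omega>, u)))\<^sup>2) \<partial>N)"
      using L2_square_integrable[OF f] by (simp add: power_mult_distrib)
    show "AE \<omega> in P. integrable N (\<lambda>u. (f (fst (\<omega>, u)) * g (snd (\<omega>, u)))\<^sup>2)"
      using L2_square_integrable[OF g] by (simp add: power_mult_distrib)
  qed measurable
  then show ?thesis
    by (simp add: L2_def case_prod_beta')
qed

lemma path_inner_measurable [measurable]:
  assumes "g \<in> L2 N"
  shows "(\<lambda>\<omega>. L2_inner N (X \<omega>) g) \<in> borel_measurable P"
proof -
  have [measurable]: "(\<lambda>(\<omega>, u). X \<omega> u) \<in> borel_measurable (P \<Otimes>\<^sub>M N)" "g \<in> borel_measurable N"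
    using process_L2 assms by (auto dest: L2_measurable)
  show ?thesis
    unfolding L2_inner_def by measurable
qed

lemma path_inner_L2:
  assumes g: "g \<in> L2 N"
  shows "(\<lambda>\<omega>. L2_inner N (X \<omega>) g) \<in> L2 P"
proof -
  have "integrable (P \<Otimes>\<^sub>M N) (\<lambda>(\<omega>, u). (X \<omega> u)\<^sup>2)"
    using L2_square_integrable[OF process_L2] by (simp add: case_prod_beta')
  then have "integrable P (\<lambda>\<omega>. \<integral>u. (X \<omega> u)\<^sup>2 \<partial>N)"
    by (rule PN.integrable_fst)
  then have "integrable P (\<lambda>\<omega>. L2_inner N (X \<omega>) (X \<omega>) * L2_inner N g g)"
    by (simp add: L2_inner_def power2_eq_square)
  then have "integrable P (\<lambda>\<omega>. (L2_inner N (X \<omega>) g)\<^sup>2)"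
  proof (rule Bochner_Integration.integrable_bound)
    show "(\<lambda>\<omega>. (L2_inner N (X \<omega>) g)\<^sup>2) \<in> borel_measurable P"
      using path_inner_measurable[OF g] by measurable
    show "AE \<omega> in P. norm ((L2_inner N (X \<omega>) g)\<^sup>2) \<le> norm (L2_inner N (X \<omega>) (X \<omega>) * L2_inner N g g)"
    proof (rule AE_I2)
      fix \<omega> assume "\<omega> \<in> space P"
      then have "\<bar>L2_inner N (X \<omega>) g\<bar>\<^sup>2 \<le> (L2_norm N (X \<omega>) * L2_norm N g)\<^sup>2"
        using L2_Cauchy_Schwarz[OF path_L2 g] by (intro power_mono) auto
      then show "norm ((L2_inner N (X \<omega>) g)\<^sup>2) \<le> norm (L2_inner N (X \<omega>) (X \<omega>) * L2_inner N g g)"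
        by (simp add: power_mult_distrib L2_norm_square)
    qed
  qed
  then show ?thesis
    using path_inner_measurable[OF g] by (simp add: L2_def)
qed

text \<open>
  Square integrability on the product gives second moments of the values only off a null set of
  arguments; integrals over the domain do not see the exceptional set.
\<close>

lemma AE_value_L2: "AE v in N. (\<lambda>\<omega>. X \<omega> v) \<in> L2 P"
proof -
  have X[measurable]: "(\<lambda>(\<omega>, u). X \<omega> u) \<in> borel_measurable (P \<Otimes>\<^sub>M N)"
    using process_L2 by (rule L2_measurable)
  have "integrable (P \<Otimes>\<^sub>M N) (\<lambda>(\<omega>, u). (X \<omega> u)\<^sup>2)"
    using L2_square_integrable[OF process_L2] by (simp add: case_prod_beta')
  then have "AE v in N. integrable P (\<lambda>\<omega>. (X \<omega> v)\<^sup>2)"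
    by (rule PN.AE_integrable_snd)
  with AE_space show ?thesis
  proof eventually_elim
    case (elim v)
    have "(\<lambda>\<omega>. X \<omega> v) \<in> borel_measurable P"
      using measurable_compose[OF measurable_Pair2'[OF elim(1)] X] by simp
    then show ?case using elim by (simp add: L2_def)
  qed
qed

lemma score_value_covariance:
  assumes g: "g \<in> L2 N" and v: "v \<in> space N" and Xv: "(\<lambda>\<omega>. X \<omega> v) \<in> L2 P"
  shows "(\<integral>\<omega>. L2_inner N (X \<omega>) g * X \<omega> v \<partial>P) = cov_operator P X N g v"
proof -
  have "integrable (P \<Otimes>\<^sub>M N) (\<lambda>(\<omega>, u). X \<omega> u * (X \<omega> v * g u))"
    using L2_mult_integrable[OF process_L2 L2_pair_product[OF Xv g]] by (simp add: case_prod_beta')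
  then have "(\<integral>u. (\<integral>\<omega>. X \<omega> u * (X \<omega> v * g u) \<partial>P) \<partial>N) = (\<integral>\<omega>. (\<integral>u. X \<omega> u * (X \<omega> v * g u) \<partial>N) \<partial>P)"
    by (rule PN.Fubini_integral)
  moreover have "(\<integral>u. X \<omega> u * (X \<omega> v * g u) \<partial>N) = L2_inner N (X \<omega>) g * X \<omega> v" for \<omega>
    unfolding L2_inner_def
    by (subst integral_mult_left_zero[symmetric]) (simp add: mult_ac)
  moreover have "(\<integral>u. (\<integral>\<omega>. X \<omega> u * (X \<omega> v * g u) \<partial>P) \<partial>N) = cov_operator P X N g v"
    unfolding cov_operator_def
  proof (rule Bochner_Integration.integral_cong)
    fix u assume "u \<in> space N"
    then have "cov_kernel P X v u * g u = (\<integral>\<omega>. X \<omega> v * X \<omega> u * g u \<partial>P)"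
      using v by (simp add: cov_kernel_def covariance_def mean_zero)
    then show "(\<integral>\<omega>. X \<omega> u * (X \<omega> v * g u) \<partial>P) = cov_kernel P X v u * g u"
      by (auto simp: mult_ac)
  qed simp
  ultimately show ?thesis by simp
qed

text \<open>
  Exchanging the expectation with one inner product produces \<open>E (\<langle>X, g\<rangle> * X(v))\<close>, and exchanging it
  with the other identifies this as the covariance operator applied to \<open>g\<close>, by the previous lemma.
  With eigenfunctions for \<open>g\<close> and \<open>h\<close> this says that the scores are uncorrelated with the eigenvalues
  as variances.
\<close>

lemma score_covariance_eigenfunction:
  assumes g: "g \<in> L2 N" and h: "h \<in> L2 N" and eigen: "ae_eq N (cov_operator P X N g) (\<lambda>u. \<mu> * g u)"
  shows "L2_inner P (\<lambda>\<omega>. L2_inner N (X \<omega>) g) (\<lambda>\<omega>. L2_inner N (X \<omega>) h) = \<mu> * L2_inner N g h"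
proof -
  let ?S = "\<lambda>\<omega>. L2_inner N (X \<omega>) g"
  have [measurable]: "g \<in> borel_measurable N" "h \<in> borel_measurable N"
    using g h by (auto dest: L2_measurable)
  have int: "integrable (P \<Otimes>\<^sub>M N) (\<lambda>(\<omega>, v). X \<omega> v * (?S \<omega> * h v))"
    using L2_mult_integrable[OF process_L2 L2_pair_product[OF path_inner_L2[OF g] h]]
    by (simp add: case_prod_beta')
  have "L2_inner P ?S (\<lambda>\<omega>. L2_inner N (X \<omega>) h) = (\<integral>\<omega>. (\<integral>v. X \<omega> v * (?S \<omega> * h v) \<partial>N) \<partial>P)"
    unfolding L2_inner_def[of N _ h] L2_inner_def[of P] integral_mult_right_zero[symmetric]
    by (simp add: mult_ac)
  also have "\<dots> = (\<integral>v. (\<integral>\<omega>. X \<omega> v * (?S \<omega> * h v) \<partial>P) \<partial>N)"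
    using PN.Fubini_integral[OF int] by simp
  also have "\<dots> = (\<integral>v. \<mu> * (g v * h v) \<partial>N)"
  proof (rule integral_cong_AE)
    show "(\<lambda>v. \<integral>\<omega>. X \<omega> v * (?S \<omega> * h v) \<partial>P) \<in> borel_measurable N"
      using PN.integrable_snd[OF int] by (rule borel_measurable_integrable)
    show "AE v in N. (\<integral>\<omega>. X \<omega> v * (?S \<omega> * h v) \<partial>P) = \<mu> * (g v * h v)"
      using AE_value_L2 AE_space eigen[unfolded ae_eq_def]
    proof eventually_elim
      case (elim v)
      have "(\<integral>\<omega>. X \<omega> v * (?S \<omega> * h v) \<partial>P) = (\<integral>\<omega>. ?S \<omega> * X \<omega> v \<partial>P) * h v"
        unfolding integral_mult_left_zero[symmetric] by (simp add: mult_ac)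
      then show ?case
        using elim by (simp add: score_value_covariance[OF g])
    qed
  qed measurable
  also have "\<dots> = \<mu> * L2_inner N g h"
    by (simp add: L2_inner_def)
  finally show ?thesis .
qed

end

section \<open>Processes with continuous paths\<close>

lemma floor_approximation_tendsto:
  "(\<lambda>n. real_of_int \<lfloor>real (Suc n) * u\<rfloor> / real (Suc n)) \<longlonglongrightarrow> u"
proof -
  have "(\<lambda>n. real_of_int \<lfloor>real (Suc n) * u\<rfloor> / real (Suc n) - u) \<longlonglongrightarrow> 0"
  proof (rule Lim_null_comparison)
    have "norm (real_of_int \<lfloor>real (Suc n) * u\<rfloor> / real (Suc n) - u) \<le> inverse (real (Suc n))" for n
    proof -
      have "\<bar>real_of_int \<lfloor>real (Suc n) * u\<rfloor> - real (Suc n) * u\<bar> \<le> 1"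
        by linarith
      then have "\<bar>real_of_int \<lfloor>real (Suc n) * u\<rfloor> - real (Suc n) * u\<bar> / real (Suc n) \<le> 1 / real (Suc n)"
        by (intro divide_right_mono) auto
      moreover have "real_of_int \<lfloor>real (Suc n) * u\<rfloor> / real (Suc n) - u
          = (real_of_int \<lfloor>real (Suc n) * u\<rfloor> - real (Suc n) * u) / real (Suc n)"
        by (simp add: diff_divide_distrib del: of_nat_Suc)
      ultimately show ?thesis
        by (simp add: inverse_eq_divide del: of_nat_Suc)
    qed
    then show "\<forall>\<^sub>F n in sequentially. norm (real_of_int \<lfloor>real (Suc n) * u\<rfloor> / real (Suc n) - u)
        \<le> inverse (real (Suc n))"
      by simp
    show "(\<lambda>n. inverse (real (Suc n))) \<longlonglongrightarrow> 0"
      by (rule LIMSEQ_inverse_real_of_nat)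
  qed
  then show ?thesis by (rule LIM_zero_cancel)
qed

text \<open>
  A process with continuous paths is jointly measurable: it is the pointwise limit of the processes
  that are frozen at the grid points \<open>i / n\<close>, clipped to the interval, and each of these takes only
  countably many arguments.
\<close>

lemma continuous_paths_jointly_measurable:
  fixes X :: "'w \<Rightarrow> real \<Rightarrow> real"
  assumes ab: "a \<le> b"
    and paths: "\<And>\<omega>. \<omega> \<in> space P \<Longrightarrow> continuous_on {a..b} (X \<omega>)"
    and measurable_values: "\<And>u. u \<in> {a..b} \<Longrightarrow> (\<lambda>\<omega>. X \<omega> u) \<in> borel_measurable P"
    and S: "S \<subseteq> {a..b}"
  shows "(\<lambda>(\<omega>, u). X \<omega> u) \<in> borel_measurable (P \<Otimes>\<^sub>M lborel_on S)"
proof (rule borel_measurable_LIMSEQ_real)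
  \<comment> \<open>Grid points next to the end points may fall outside the interval, where nothing is known
    about the values of the process.\<close>
  define clip where "clip t = max a (min b t)" for t :: real
  have clip: "clip t \<in> {a..b}" for t
    using ab by (auto simp: clip_def)
  let ?q = "\<lambda>n u. clip (real_of_int \<lfloor>real (Suc n) * u\<rfloor> / real (Suc n))"
  show "(\<lambda>p. X (fst p) (?q n (snd p))) \<in> borel_measurable (P \<Otimes>\<^sub>M lborel_on S)" for n
  proof (rule measurable_compose_countable[where g = "\<lambda>p. \<lfloor>real (Suc n) * snd p\<rfloor>"
        and f = "\<lambda>i p. X (fst p) (clip (real_of_int i / real (Suc n)))"])
    show "(\<lambda>p. X (fst p) (clip (real_of_int i / real (Suc n)))) \<in> borel_measurable (P \<Otimes>\<^sub>M lborel_on S)" for i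
      by (intro measurable_compose[OF measurable_fst] measurable_values clip)
    have [measurable]: "(\<lambda>u. u) \<in> borel_measurable (lborel_on S)"
      by (intro measurable_restrict_space1) simp
    have "snd \<in> borel_measurable (P \<Otimes>\<^sub>M lborel_on S)"
      using measurable_compose[OF measurable_snd, of "\<lambda>u. u" "lborel_on S" borel P] by simp
    then show "(\<lambda>p. \<lfloor>real (Suc n) * snd p\<rfloor>) \<in> measurable (P \<Otimes>\<^sub>M lborel_on S) (count_space UNIV)"
      by measurable
  qed
  fix p assume p: "p \<in> space (P \<Otimes>\<^sub>M lborel_on S)"
  then have \<omega>: "fst p \<in> space P" and u: "snd p \<in> {a..b}"
    using S by (auto simp: space_pair_measure space_restrict_space)
  have "(\<lambda>n. ?q n (snd p)) \<longlonglongrightarrow> clip (snd p)"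
    unfolding clip_def by (intro tendsto_intros floor_approximation_tendsto)
  moreover have "clip (snd p) = snd p"
    using u by (auto simp: clip_def)
  ultimately have "(\<lambda>n. ?q n (snd p)) \<longlonglongrightarrow> snd p" by simp
  then have "(\<lambda>n. X (fst p) (?q n (snd p))) \<longlonglongrightarrow> X (fst p) (snd p)"
    using clip u by (intro continuous_on_tendsto_compose[OF paths[OF \<omega>]]) auto
  then show "(\<lambda>n. X (fst p) (?q n (snd p))) \<longlonglongrightarrow> (case p of (\<omega>, u) \<Rightarrow> X \<omega> u)"
    by (simp add: case_prod_beta')
qed

lemma continuous_on_compact_L2:
  fixes f :: "real \<Rightarrow> real"
  assumes S: "compact S" and f: "continuous_on S f"
  shows "f \<in> L2 (lborel_on S)"
proof -
  have [simp]: "S \<in> sets borel"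
    using S by (intro borel_closed compact_imp_closed)
  have "(\<lambda>x. indicator S x *\<^sub>R f x) \<in> borel_measurable lborel"
    using borel_integrable_compact[OF S f] by (rule borel_measurable_integrable)
  moreover have "integrable lborel (\<lambda>x. indicator S x *\<^sub>R (f x)\<^sup>2)"
    using S f by (intro borel_integrable_compact continuous_on_power)
  ultimately show ?thesis
    by (simp add: L2_def integrable_restrict_space borel_measurable_restrict_space_iff)
qed

lemma L2_inner_self_mono_set:
  assumes "S \<in> sets borel" and "T \<in> sets borel" and "S \<subseteq> T"
    and f: "f \<in> L2 (lborel_on T)" "f \<in> L2 (lborel_on S)"
  shows "L2_inner (lborel_on S) f f \<le> L2_inner (lborel_on T) f f"
  using assms L2_square_integrable[OF f(1)] L2_square_integrable[OF f(2)]
  by (auto simp: L2_inner_def integral_restrict_space integrable_restrict_space power2_eq_square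
      indicator_def intro!: integral_mono)

text \<open>
  By \<open>s \<le> 1 + s\<^sup>2\<close> for the squared norm \<open>s\<close>, the fourth moment of the norm bounds the second. By Tonelli's
  theorem, the second moment of the norm over \<open>S\<close> is the integral of \<open>X\<^sup>2\<close> over the product.
\<close>

lemma continuous_process_square_integrable:
  fixes X :: "'w \<Rightarrow> real \<Rightarrow> real"
  assumes prob: "prob_space P"
    and ab: "a \<le> b"
    and paths: "\<And>\<omega>. \<omega> \<in> space P \<Longrightarrow> continuous_on {a..b} (X \<omega>)"
    and integrable_values: "\<And>u. u \<in> {a..b} \<Longrightarrow> integrable P (\<lambda>\<omega>. X \<omega> u)"
    and centered: "\<And>u. u \<in> {a..b} \<Longrightarrow> (\<integral>\<omega>. X \<omega> u \<partial>P) = 0"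
    and fourth_moment: "integrable P (\<lambda>\<omega>. (L2_norm (lborel_on {a..b}) (X \<omega>)) ^ 4)"
    and S: "compact S" "S \<subseteq> {a..b}"
  shows "square_integrable_process P (lborel_on S) X"
proof -
  let ?N = "lborel_on S"
  interpret P: prob_space P by (fact prob)
  have S_borel: "S \<in> sets borel"
    using S(1) by (intro borel_closed compact_imp_closed)
  interpret N: sigma_finite_measure ?N
    using S_borel by (intro sigma_finite_measure_restrict_space lborel.sigma_finite_measure_axioms) simp
  interpret PN: pair_sigma_finite P ?N ..
  have X[measurable]: "(\<lambda>(\<omega>, u). X \<omega> u) \<in> borel_measurable (P \<Otimes>\<^sub>M ?N)"
    using ab paths integrable_values S(2)
    by (intro continuous_paths_jointly_measurable[where a = a and b = b]) auto
  have path_L2: "X \<omega> \<in> L2 ?N" "X \<omega> \<in> L2 (lborel_on {a..b})" if "\<omega> \<in> space P" for \<omega>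
    using paths[OF that] S continuous_on_subset by (auto intro!: continuous_on_compact_L2)
  have "integrable P (\<lambda>\<omega>. 1 + (L2_norm (lborel_on {a..b}) (X \<omega>)) ^ 4)"
    using fourth_moment by simp
  then have "integrable P (\<lambda>\<omega>. \<integral>u. (X \<omega> u)\<^sup>2 \<partial>?N)"
  proof (rule Bochner_Integration.integrable_bound)
    show "(\<lambda>\<omega>. \<integral>u. (X \<omega> u)\<^sup>2 \<partial>?N) \<in> borel_measurable P"
      by measurable
    show "AE \<omega> in P. norm (\<integral>u. (X \<omega> u)\<^sup>2 \<partial>?N) \<le> norm (1 + (L2_norm (lborel_on {a..b}) (X \<omega>)) ^ 4)"
    proof (rule AE_I2)
      fix \<omega> assume \<omega>: "\<omega> \<in> space P"
      let ?s = "L2_inner (lborel_on {a..b}) (X \<omega>) (X \<omega>)"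
      have "(\<integral>u. (X \<omega> u)\<^sup>2 \<partial>?N) = L2_inner ?N (X \<omega>) (X \<omega>)"
        by (simp add: L2_inner_def power2_eq_square)
      also have "\<dots> \<le> ?s"
        using S_borel S(2) path_L2[OF \<omega>] by (intro L2_inner_self_mono_set) auto
      also have "?s \<le> 1 + ?s\<^sup>2"
      proof -
        have "2 * ?s \<le> ?s\<^sup>2 + 1"
          using zero_le_power2[of "?s - 1"] by (simp add: power2_diff)
        then show ?thesis
          using L2_inner_self_nonneg[of "lborel_on {a..b}" "X \<omega>"] by linarith
      qed
      also have "?s\<^sup>2 = (L2_norm (lborel_on {a..b}) (X \<omega>)) ^ 4"
        by (simp flip: L2_norm_square power_mult)
      finally show "norm (\<integral>u. (X \<omega> u)\<^sup>2 \<partial>?N) \<le> norm (1 + (L2_norm (lborel_on {a..b}) (X \<omega>)) ^ 4)"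
        by simp
    qed
  qed
  then have "integrable (P \<Otimes>\<^sub>M ?N) (\<lambda>p. (X (fst p) (snd p))\<^sup>2)"
    using path_L2 by (intro PN.Fubini_integrable) (auto intro!: AE_I2 L2_square_integrable)
  then have "(\<lambda>(\<omega>, u). X \<omega> u) \<in> L2 (P \<Otimes>\<^sub>M ?N)"
    using X by (simp add: L2_def case_prod_beta')
  moreover have "(\<integral>\<omega>. X \<omega> u \<partial>P) = 0" if "u \<in> space ?N" for u
    using that S(2) by (auto intro: centered simp: space_restrict_space)
  ultimately show ?thesis
    using path_L2(1) by unfold_locales
qed

section \<open>Representation of reconstruction operators\<close>

lemma L2_linear_operator_add:
  assumes "L2_linear_operator N N' L" and "u \<in> space N'" and "f \<in> L2 N" and "g \<in> L2 N"
  shows "L (\<lambda>x. f x + g x) u = L f u + L g u"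
  using assms by (simp add: L2_linear_operator_def)

lemma L2_linear_operator_scale:
  assumes "L2_linear_operator N N' L" and "u \<in> space N'" and "f \<in> L2 N"
  shows "L (\<lambda>x. c * f x) u = c * L f u"
  using assms by (simp add: L2_linear_operator_def)

lemma L2_linear_operator_sum:
  assumes L: "L2_linear_operator N N' L" and u: "u \<in> space N'" and f: "\<And>k. f k \<in> L2 N"
  shows "L (\<lambda>x. \<Sum>k<n. c k * f k x) u = (\<Sum>k<(n::nat). c k * L (f k) u)"
proof (induction n)
  case 0
  show ?case
    using L2_linear_operator_scale[OF L u f, of 0 0] by simp
next
  case (Suc n)
  have cf: "(\<lambda>x. c n * f n x) \<in> L2 N" and sum: "(\<lambda>x. \<Sum>k<n. c k * f k x) \<in> L2 N"
    by (intro L2_scale L2_sum f)+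
  have "L (\<lambda>x. (\<Sum>k<n. c k * f k x) + c n * f n x) u
      = L (\<lambda>x. \<Sum>k<n. c k * f k x) u + L (\<lambda>x. c n * f n x) u"
    using L u sum cf by (rule L2_linear_operator_add)
  also have "L (\<lambda>x. c n * f n x) u = c n * L (f n) u"
    using L u f by (rule L2_linear_operator_scale)
  finally show ?case using Suc.IH by simp
qed

lemma L2_linear_operator_diff:
  assumes L: "L2_linear_operator N N' L" and u: "u \<in> space N'" and f: "f \<in> L2 N" and g: "g \<in> L2 N"
  shows "L (\<lambda>x. f x - g x) u = L f u - L g u"
proof -
  have "L (\<lambda>x. f x + - 1 * g x) u = L f u + L (\<lambda>x. - 1 * g x) u"
    using L u f L2_scale[OF g] by (rule L2_linear_operator_add)
  also have "L (\<lambda>x. - 1 * g x) u = - 1 * L g u"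
    using L u g by (rule L2_linear_operator_scale)
  finally show ?thesis by simp
qed

text \<open>\<open>Y\<^sup>2 = (Y - m)\<^sup>2 + 2 * m * Y - m\<^sup>2\<close> with the mean \<open>m\<close>.\<close>

lemma (in prob_space) finite_variance_L2:
  assumes "finite_variance M Y"
  shows "Y \<in> L2 M"
proof -
  let ?m = "\<integral>w. Y w \<partial>M"
  have "integrable M (\<lambda>w. (Y w - ?m)\<^sup>2 + 2 * ?m * Y w - ?m\<^sup>2)"
    using assms by (simp add: finite_variance_def)
  moreover have "(Y w - ?m)\<^sup>2 + 2 * ?m * Y w - ?m\<^sup>2 = (Y w)\<^sup>2" for w
    by (simp add: power2_diff)
  ultimately show ?thesis
    using assms by (simp add: finite_variance_def L2_def)
qed

lemma L2_norm_cong: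
  "(\<And>x. x \<in> space M \<Longrightarrow> f x = g x) \<Longrightarrow> L2_norm M f = L2_norm M g"
  unfolding L2_norm_def L2_inner_def by (intro arg_cong[where f = sqrt] Bochner_Integration.integral_cong) auto

theorem theorem2p1:
  fixes P :: "'w measure" and X :: "'w \<Rightarrow> real \<Rightarrow> real"
    and a b :: real and J :: nat and A B :: "nat \<Rightarrow> real" and Obs Mis :: "real set"
    and \<phi> :: "nat \<Rightarrow> real \<Rightarrow> real" and lam :: "nat \<Rightarrow> real"
    and L :: "(real \<Rightarrow> real) \<Rightarrow> real \<Rightarrow> real"
  assumes prob: "prob_space P"
    and continuous_paths: "\<And>\<omega>. \<omega> \<in> space P \<Longrightarrow> continuous_on {a..b} (X \<omega>)"
    and integrable_values: "\<And>u. u \<in> {a..b} \<Longrightarrow> integrable P (\<lambda>\<omega>. X \<omega> u)"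
    and centered: "\<And>u. u \<in> {a..b} \<Longrightarrow> (\<integral>\<omega>. X \<omega> u \<partial>P) = 0"
    and fourth_moment: "integrable P (\<lambda>\<omega>. (L2_norm (lborel_on {a..b}) (X \<omega>)) ^ 4)"
    and intervals: "1 \<le> J" "\<And>j. j \<in> {1..J} \<Longrightarrow> A j < B j"
      "disjoint_family_on (\<lambda>j. {A j..B j}) {1..J}"
    and observed: "Obs = (\<Union>j\<in>{1..J}. {A j..B j})" "Obs \<subseteq> {a..b}"
    and missing: "Mis = {a..b} - Obs"
    and eigen: "eigensystem (lborel_on Obs) (cov_operator P X (lborel_on Obs)) \<phi> lam"
    and reconstruction: "reconstruction_operator P X (lborel_on Obs) (lborel_on Mis) L"
    and continuity: "mean_square_continuous_along_KL P (lborel_on Obs) \<phi> X (lborel_on Mis) L"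
  shows "(\<forall>f\<in>H_space (lborel_on Obs) \<phi> lam. \<forall>g\<in>H_space (lborel_on Obs) \<phi> lam.
            summable (\<lambda>k. L2_inner (lborel_on Obs) f (\<phi> k) * L2_inner (lborel_on Obs) g (\<phi> k) / lam k))
       \<and> hilbert_space_ae (lborel_on Obs) (H_space (lborel_on Obs) \<phi> lam)
            (H_inner (lborel_on Obs) \<phi> lam)
       \<and> (\<forall>u\<in>Mis. \<exists>\<alpha>\<in>H_space (lborel_on Obs) \<phi> lam.
            (\<exists>Z. is_H_pairing P (lborel_on Obs) \<phi> lam X \<alpha> Z \<and> (AE \<omega> in P. L (X \<omega>) u = Z \<omega>)) \<and>
            (\<forall>\<beta>\<in>H_space (lborel_on Obs) \<phi> lam.
               (\<exists>Z. is_H_pairing P (lborel_on Obs) \<phi> lam X \<beta> Z \<and> (AE \<omega> in P. L (X \<omega>) u = Z \<omega>))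
               \<longrightarrow> ae_eq (lborel_on Obs) \<beta> \<alpha>))"
proof -
  let ?N = "lborel_on Obs" and ?N' = "lborel_on Mis"
  have "1 \<in> {1..J}" using intervals(1) by simp
  then have "A 1 \<in> Obs"
    using intervals(2)[of 1] by (auto simp: observed(1) intro!: bexI[of _ 1])
  then have ab: "a \<le> b" using observed(2) by auto
  have Obs_compact: "compact Obs"
    unfolding observed(1) by (intro compact_UN) auto
  interpret process: square_integrable_process P ?N X
    using prob ab continuous_paths integrable_values centered fourth_moment Obs_compact observed(2)
    by (rule continuous_process_square_integrable)
  interpret weighted_orthonormal_sequence ?N \<phi> lam
  proof
    show "\<phi> k \<in> L2 ?N" "L2_inner ?N (\<phi> k) (\<phi> l) = (if k = l then 1 else 0)" "0 < lam k" for k l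
      using eigen by (auto simp: eigensystem_def)
    have "lam k \<le> lam 0" for k
      using eigen by (cases k) (auto simp: eigensystem_def less_imp_le)
    then show "bdd_above (range lam)" by (auto simp: bdd_above_def)
  qed
  let ?\<xi> = "score ?N \<phi> X"
  let ?H = "H_space ?N \<phi> lam"
  have \<xi>_L2: "?\<xi> k \<in> L2 P" for k
    unfolding score_def[abs_def] by (intro process.path_inner_L2 basis_L2)
  have \<xi>_orthogonal: "L2_inner P (?\<xi> k) (?\<xi> l) = (if k = l then lam k else 0)" for k l
  proof -
    have "ae_eq ?N (cov_operator P X ?N (\<phi> k)) (\<lambda>u. lam k * \<phi> k u)"
      using eigen by (simp add: eigensystem_def)
    then show ?thesis
      using process.score_covariance_eigenfunction[OF basis_L2 basis_L2]
      by (simp add: score_def[abs_def] basis_inner)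
  qed
  have pairing_coefficient: "L2_inner ?N \<alpha> (\<phi> k) = L2_inner P Z (?\<xi> k)"
    if "is_H_pairing P ?N \<phi> lam X \<alpha> Z" for \<alpha> Z k
  proof -
    have "L2_inner P Z (?\<xi> k) = L2_inner ?N \<alpha> (\<phi> k) / lam k * lam k"
      using that
      by (intro L2_series_coefficient[of ?\<xi> P lam Z "\<lambda>k. L2_inner ?N \<alpha> (\<phi> k) / lam k", OF \<xi>_L2 \<xi>_orthogonal])
        (simp_all add: is_H_pairing_def mult.commute)
    then show ?thesis using weight_pos[of k] by simp
  qed
  have representation: "\<exists>\<alpha>\<in>?H. (\<exists>Z. is_H_pairing P ?N \<phi> lam X \<alpha> Z \<and> (AE \<omega> in P. L (X \<omega>) u = Z \<omega>)) \<and>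
      (\<forall>\<beta>\<in>?H. (\<exists>Z. is_H_pairing P ?N \<phi> lam X \<beta> Z \<and> (AE \<omega> in P. L (X \<omega>) u = Z \<omega>)) \<longrightarrow> ae_eq ?N \<beta> \<alpha>)"
    if "u \<in> Mis" for u
  proof -
    have u: "u \<in> space ?N'" using that by (simp add: space_restrict_space)
    have L: "L2_linear_operator ?N ?N' L" and "finite_variance P (\<lambda>\<omega>. L (X \<omega>) u)"
      using reconstruction u by (auto simp: reconstruction_operator_def)
    define Y where "Y \<omega> = L (X \<omega>) u" for \<omega>
    have Y: "Y \<in> L2 P"
      using process.P.finite_variance_L2[OF \<open>finite_variance P _\<close>] by (simp add: Y_def[abs_def])
    have Y_series: "(\<lambda>n. L2_norm P (\<lambda>\<omega>. Y \<omega> - (\<Sum>k<n. L (\<phi> k) u * ?\<xi> k \<omega>))) \<longlonglongrightarrow> 0"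
    proof -
      have "L (\<lambda>t. X \<omega> t - (\<Sum>k<n. ?\<xi> k \<omega> * \<phi> k t)) u = Y \<omega> - (\<Sum>k<n. L (\<phi> k) u * ?\<xi> k \<omega>)"
        if "\<omega> \<in> space P" for \<omega> n
        using L2_linear_operator_diff[OF L u process.path_L2[OF that] combination_L2]
          L2_linear_operator_sum[where f = \<phi>, OF L u basis_L2]
        by (simp add: Y_def mult.commute[of "L _ u"])
      then have eq: "L2_norm P (\<lambda>\<omega>. L (\<lambda>t. X \<omega> t - (\<Sum>k<n. ?\<xi> k \<omega> * \<phi> k t)) u)
          = L2_norm P (\<lambda>\<omega>. Y \<omega> - (\<Sum>k<n. L (\<phi> k) u * ?\<xi> k \<omega>))" for n
        by (intro L2_norm_cong)
      have "(\<lambda>n. L2_norm P (\<lambda>\<omega>. L (\<lambda>t. X \<omega> t - (\<Sum>k<n. ?\<xi> k \<omega> * \<phi> k t)) u)) \<longlonglongrightarrow> 0"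
        using continuity u unfolding mean_square_continuous_along_KL_def by (rule bspec)
      then show ?thesis by (simp only: eq)
    qed
    have Y_coefficient: "L2_inner P Y (?\<xi> k) = L (\<phi> k) u * lam k" for k
      using \<xi>_L2 \<xi>_orthogonal Y Y_series by (rule L2_series_coefficient)
    have "summable (\<lambda>k. (L2_inner P Y (?\<xi> k))\<^sup>2 / lam k)"
      using \<xi>_L2 \<xi>_orthogonal weight_pos Y by (rule L2_orthogonal_coefficients_summable)
    \<comment> \<open>The coefficients of any parameter function are forced to be the covariances of \<open>Y\<close> with the
      scores, so these define it.\<close>
    then obtain \<alpha> where \<alpha>: "\<alpha> \<in> ?H" and \<alpha>_coefficient: "\<And>k. L2_inner ?N \<alpha> (\<phi> k) = L2_inner P Y (?\<xi> k)"
      by (rule H_space_coefficients_surj) blast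
    have "?\<xi> k \<omega> * L2_inner ?N \<alpha> (\<phi> k) / lam k = L (\<phi> k) u * ?\<xi> k \<omega>" for k \<omega>
      using weight_pos[of k] by (simp add: \<alpha>_coefficient Y_coefficient)
    then have "is_H_pairing P ?N \<phi> lam X \<alpha> Y"
      using \<xi>_L2 Y Y_series by (simp add: is_H_pairing_def)
    moreover have "ae_eq ?N \<beta> \<alpha>"
      if \<beta>: "\<beta> \<in> ?H" and Z: "is_H_pairing P ?N \<phi> lam X \<beta> Z" "AE \<omega> in P. L (X \<omega>) u = Z \<omega>" for \<beta> Z
    proof -
      have "L2_inner P Y (?\<xi> k) = L2_inner P Z (?\<xi> k)" for k
        using Z Y by (intro L2_inner_ae_eq \<xi>_L2) (auto simp: is_H_pairing_def ae_eq_def Y_def)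
      then have "L2_inner ?N \<beta> (\<phi> k) = L2_inner ?N \<alpha> (\<phi> k)" for k
        by (simp add: pairing_coefficient[OF Z(1)] \<alpha>_coefficient)
      then show ?thesis
        by (intro closed_span_coefficients_inject H_space_closed_span \<alpha> \<beta>)
    qed
    ultimately show ?thesis
      using \<alpha> by (intro bexI[of _ \<alpha>]) (auto simp: Y_def intro!: exI[of _ Y])
  qed
  show ?thesis
    using H_product_summable H_space_hilbert representation by blast
qed

end
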